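(* Let $0 < \gamma \leq \frac{1}{2}$. Then there exists a strictly increasing sequence $(a_n)_{n \geq 1}$ of positive integers such that for almost all $\alpha \in \mathbb{R}$ (with respect to Lebesgue measure), the discrepancy $D_N$ of the sequence $(\{a_n \alpha\})_{n \geq 1}$ satisfies $$ N D_N = \mathcal{O}(N^{\gamma}) \quad \text{as } N \to \infty,$$ and, for every $\varepsilon > 0$, $$ N D_N = \Omega(N^{\gamma - \varepsilon}),$$ i.e. $\limsup_{N\to\infty} \frac{N D_N}{N^{\gamma-\varepsilon}} > 0$.
   Context: For $x \in \mathbb{R}$, $\{x\}$ denotes the fractional part of $x$. For a sequence $(x_n)_{n\ge1}$ of points in $[0,1)$, the discrepancy of its first $N$ terms is $$D_N = D_N(x_1,\dots,x_N) = \sup_{0 \le a < b \le 1} \left| \frac{\mathcal{A}_N([a,b))}{N} - (b-a)\right|,$$ where $\mathcal{A}_N([a,b)) = \#\{1 \le n \le N : x_n \in [a,b)\}$. The implied constant in $\mathcal{O}$ may depend on $\alpha$. *)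

theory Defs
  imports "HOL-Analysis.Analysis" "HOL-Library.Landau_Symbols"
begin

(* Sequences are indexed from 1, so the value x 0 is never used. *)

definition count_in :: "(nat \<Rightarrow> real) \<Rightarrow> nat \<Rightarrow> real set \<Rightarrow> nat" where
  "count_in x N I = card {n \<in> {1..N}. x n \<in> I}"

definition discrepancy :: "(nat \<Rightarrow> real) \<Rightarrow> nat \<Rightarrow> real" where
  "discrepancy x N =
     (SUP (a, b) \<in> {(a, b). 0 \<le> a \<and> a < b \<and> b \<le> 1}.
        \<bar>real (count_in x N {a..<b}) / real N - (b - a)\<bar>)"

end

theory Submission
  imports Defs "HOL-Computational_Algebra.Polynomial" "HOL-Real_Asymp.Real_Asymp"
begin

text \<open>
  The multiples of almost every \<open>\<alpha>\<close> along consecutive integers have discrepancy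
  \<open>N D\<^sub>N = O(N\<^sup>\<delta>)\<close> for every \<open>\<delta> > 0\<close>, uniformly in the starting point, whereas the multiples along \<open>M\<close>
  powers \<open>b\<^sup>j\<close> behave like \<open>M\<close> independent uniform points, because their leading digits are the base-\<open>b\<close>
  digits of \<open>\<alpha>\<close>; their deviation is \<open>\<surd>M\<close> up to powers of \<open>log M\<close>. In stage \<open>m\<close> the sequence takes a
  run of consecutive integers followed by \<open>2\<^sup>m\<close> consecutive powers of \<open>2\<^sup>m\<^sup>+\<^sup>1\<close>. The length \<open>L\<close> of the
  run is chosen such that \<open>L\<^sup>\<gamma> \<approx> 2\<^bsup>m/2\<^esup> (m + 2)\<^sup>4\<close>, so that the powers determine the discrepancy, and the
  logarithmic factor absorbs the loss in the upper bound for the powers. Upper and lower bounds for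
  the powers hold for almost all \<open>\<alpha>\<close> from some stage on: the former by second moments
  on dyadic rectangles, the latter because a binomial distribution gives each value mass at most
  \<open>M\<^bsup>-1/2\<^esup>\<close>.
\<close>

section \<open>Consecutive integers\<close>

text \<open>The runs have to supply most of the terms and the powers most of the deviation. This is
  possible only for \<gamma> \<le> 1/2: a run with \<open>L powr \<gamma>\<close> of order at least
  \<open>2 powr (m / 2)\<close> has at least as many elements as the \<open>2 ^ m\<close> powers
  after it. The base grows with the stage because one digit has to locate a point well enough: with
  \<open>2 ^ m\<close> points and base \<open>2 ^ (m + 1)\<close>, rounding an interval to multiples
  of 1/b changes the deviation by O(1) in total. Different points then read different digits of
  \<alpha>, so independence is exact and every probability becomes a count of integers below a power
  of b. Distinct stages need no mutual independence, since only the convergence half of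
  Borel-Cantelli is used; the first exponent J of a block is therefore arbitrary. The upper bound
  loses no further factor in the sum over stages, because the admissible deviations grow
  geometrically. The lower bound needs no control of earlier terms, since a block of powers is the
  difference of two initial segments of the sequence. \<open>dev\<close> is indexed by sets of
  integers, so that both arguments are pure additivity.\<close>

definition dev :: "real \<Rightarrow> nat set \<Rightarrow> real \<Rightarrow> real \<Rightarrow> real" where
  "dev \<alpha> F a b = (\<Sum>n\<in>F. (indicator {a..<b} (frac (real n * \<alpha>)) - (b - a)))"

lemma dev_empty [simp]: "dev \<alpha> {} a b = 0"
  by (simp add: dev_def)

lemma dev_Un_disjoint:
  "finite F \<Longrightarrow> finite G \<Longrightarrow> F \<inter> G = {} \<Longrightarrow> dev \<alpha> (F \<union> G) a b = dev \<alpha> F a b + dev \<alpha> G a b"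
  unfolding dev_def by (rule sum.union_disjoint)

lemma dev_eq_card:
  assumes "finite F"
  shows "dev \<alpha> F a b = real (card {n \<in> F. frac (real n * \<alpha>) \<in> {a..<b}}) - (b - a) * real (card F)"
proof -
  have "(\<Sum>n\<in>F. indicator {a..<b} (frac (real n * \<alpha>)))
      = (\<Sum>n\<in>{n \<in> F. frac (real n * \<alpha>) \<in> {a..<b}}. (1::real))"
    using assms by (intro sum.mono_neutral_cong_right) (auto simp: indicator_def)
  then show ?thesis
    by (simp add: dev_def sum_subtractf)
qed

lemma dev_combine:
  assumes "a \<le> b" "b \<le> c"
  shows "dev \<alpha> F a b + dev \<alpha> F b c = dev \<alpha> F a c"
  unfolding dev_def sum.distrib[symmetric]
  using assms by (intro sum.cong) (auto simp: indicator_def)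

lemma dev_unit: "dev \<alpha> F 0 1 = 0"
  unfolding dev_def by (intro sum.neutral) (auto simp: indicator_def frac_ge_0 frac_lt_1)

lemma abs_dev_le_card:
  assumes "0 \<le> a" "a \<le> b" "b \<le> 1"
  shows "\<bar>dev \<alpha> F a b\<bar> \<le> real (card F)"
proof -
  have "\<bar>dev \<alpha> F a b\<bar> \<le> (\<Sum>n\<in>F. \<bar>indicator {a..<b} (frac (real n * \<alpha>)) - (b - a)\<bar>)"
    unfolding dev_def by (rule sum_abs)
  also have "\<dots> \<le> (\<Sum>n\<in>F. 1)"
    using assms by (intro sum_mono) (auto simp: indicator_def)
  finally show ?thesis by simp
qed

text \<open>The complement of [a, b) in [0, 1) consists of two intervals, and the three deviations
  sum to zero. Hence one-sided estimates suffice throughout, at the price of a factor 2.\<close>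

lemma abs_dev_le_of_upper:
  assumes up: "\<And>a b. 0 \<le> a \<Longrightarrow> a \<le> b \<Longrightarrow> b \<le> 1 \<Longrightarrow> dev \<alpha> F a b \<le> C"
    and ab: "0 \<le> a" "a \<le> b" "b \<le> 1"
  shows "\<bar>dev \<alpha> F a b\<bar> \<le> 2 * C"
proof -
  have "dev \<alpha> F 0 a + dev \<alpha> F a b + dev \<alpha> F b 1 = 0"
    using dev_combine[of 0 a b \<alpha> F] dev_combine[of 0 b 1 \<alpha> F] dev_unit ab by simp
  moreover have "dev \<alpha> F 0 a \<le> C" "dev \<alpha> F b 1 \<le> C" "dev \<alpha> F a b \<le> C"
    using ab by (auto intro!: up)
  moreover have "0 \<le> C"
    using up[of 0 1] dev_unit[of \<alpha> F] by simp
  ultimately show ?thesis by linarith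
qed

lemma card_ints_in_interval:
  fixes x y :: real
  assumes "x \<le> y"
  shows "finite {z::int. x \<le> z \<and> z < y}" "real (card {z::int. x \<le> z \<and> z < y}) \<le> y - x + 1"
proof -
  have eq: "{z::int. x \<le> z \<and> z < y} = {\<lceil>x\<rceil>..<\<lceil>y\<rceil>}"
    by (auto simp: ceiling_le_iff less_ceiling_iff)
  then show "finite {z::int. x \<le> z \<and> z < y}" by simp
  have "\<lceil>x\<rceil> \<le> \<lceil>y\<rceil>" using assms by (rule ceiling_mono)
  then have "real (card {z::int. x \<le> z \<and> z < y}) = of_int \<lceil>y\<rceil> - of_int \<lceil>x\<rceil>"
    unfolding eq by simp
  then show "real (card {z::int. x \<le> z \<and> z < y}) \<le> y - x + 1"
    by linarith
qed

text \<open>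
  If \<open>n \<alpha>\<close> falls into \<open>[a, b)\<close> modulo 1, then \<open>(n - B) p - \<lfloor>n \<alpha>\<rfloor> q\<close> lies in an interval of length
  \<open>q (b - a) + 2\<close>, and these integers are distinct since \<open>p\<close> is invertible modulo \<open>q\<close>.
\<close>

lemma abs_dev_complete_block:
  fixes p :: int and q :: nat
  assumes q: "0 < q" and cop: "coprime p (int q)" and app: "\<bar>real q * \<alpha> - p\<bar> \<le> 1 / q"
    and ab: "0 \<le> a" "a \<le> b" "b \<le> 1"
  shows "\<bar>dev \<alpha> {B..<B + q} a b\<bar> \<le> 6"
proof -
  \<comment> \<open>An interval of length q (b - a) + 2 holds at most q (b - a) + 3 integers, and q
    (b - a) is the expected number. The passage to absolute values doubles 3 to 6.\<close>
  have "dev \<alpha> {B..<B + q} a b \<le> 3" if ab: "0 \<le> a" "a \<le> b" "b \<le> 1" for a b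
  proof -
    define S where "S = {n \<in> {B..<B + q}. frac (real n * \<alpha>) \<in> {a..<b}}"
    define f where "f n = int (n - B) * p - \<lfloor>real n * \<alpha>\<rfloor> * int q" for n
    define T where "T = {z::int. q * (a - B * \<alpha>) - 1 \<le> z \<and> z < q * (b - B * \<alpha>) + 1}"
    have T: "finite T" "real (card T) \<le> q * (b - a) + 3"
    proof -
      have "q * (a - B * \<alpha>) \<le> q * (b - B * \<alpha>)" using ab by (intro mult_left_mono) auto
      then have le: "q * (a - B * \<alpha>) - 1 \<le> q * (b - B * \<alpha>) + 1" by linarith
      show "finite T" unfolding T_def by (rule card_ints_in_interval(1)[OF le])
      show "real (card T) \<le> q * (b - a) + 3"
        using card_ints_in_interval(2)[OF le] unfolding T_def right_diff_distrib by linarith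
    qed
    have "inj_on f S"
    proof (rule inj_onI)
      fix n n' assume n: "n \<in> S" "n' \<in> S" "f n = f n'"
      have "(int (n - B) - int (n' - B)) * p = (\<lfloor>real n * \<alpha>\<rfloor> - \<lfloor>real n' * \<alpha>\<rfloor>) * int q"
        using n(3) by (simp add: f_def algebra_simps)
      then have "int q dvd (int (n - B) - int (n' - B)) * p" by simp
      then have d: "int q dvd (int (n - B) - int (n' - B))"
        using cop by (simp add: coprime_dvd_mult_left_iff coprime_commute)
      have "\<bar>int (n - B) - int (n' - B)\<bar> < int q"
        using n by (auto simp: S_def)
      then have "int (n - B) - int (n' - B) = 0"
        using d by (metis dvd_imp_le_int abs_of_nat not_le)
      then show "n = n'"
        using n by (auto simp: S_def)
    qed
    moreover have "f ` S \<subseteq> T"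
    proof
      fix z assume "z \<in> f ` S"
      then obtain n where n: "n \<in> S" "z = f n" by auto
      define i where "i = n - B"
      have i: "n = B + i" "i < q" using n by (auto simp: S_def i_def)
      have fr: "a \<le> real n * \<alpha> - \<lfloor>real n * \<alpha>\<rfloor>" "real n * \<alpha> - \<lfloor>real n * \<alpha>\<rfloor> < b"
        using n by (auto simp: S_def frac_def)
      have "\<bar>real i * (real q * \<alpha> - p)\<bar> \<le> real q * (1 / q)"
        unfolding abs_mult using i app by (intro mult_mono) auto
      then have e: "\<bar>real i * (real q * \<alpha> - p)\<bar> \<le> 1" using q by simp
      have z: "real_of_int z = q * (real n * \<alpha> - \<lfloor>real n * \<alpha>\<rfloor>) - q * (B * \<alpha>) - real i * (real q * \<alpha> - p)"
        unfolding n f_def by (simp add: i algebra_simps)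
      have "q * a \<le> q * (real n * \<alpha> - \<lfloor>real n * \<alpha>\<rfloor>)" "q * (real n * \<alpha> - \<lfloor>real n * \<alpha>\<rfloor>) < q * b"
        using fr q by (auto intro: mult_left_mono)
      then show "z \<in> T"
        using e unfolding T_def mem_Collect_eq z right_diff_distrib[of _ a] right_diff_distrib[of _ b]
        by linarith
    qed
    ultimately have "card S \<le> card T"
      using T(1) by (metis card_image card_mono)
    then have "real (card S) \<le> q * (b - a) + 3" using T by linarith
    then show ?thesis
      unfolding dev_eq_card[OF finite_atLeastLessThan] S_def[symmetric] by (simp add: mult.commute)
  qed
  from abs_dev_le_of_upper[OF this ab] show ?thesis by simp
qed

lemma abs_dev_complete_blocks:
  fixes p :: int and q :: nat
  assumes "0 < q" "coprime p (int q)" "\<bar>real q * \<alpha> - p\<bar> \<le> 1 / q" "0 \<le> a" "a \<le> b" "b \<le> 1"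
  shows "\<bar>dev \<alpha> {B..<B + k * q} a b\<bar> \<le> 6 * k"
proof (induction k)
  case (Suc k)
  have "{B..<B + Suc k * q} = {B..<B + k * q} \<union> {B + k * q..<B + k * q + q}" by auto
  then have "dev \<alpha> {B..<B + Suc k * q} a b
      = dev \<alpha> {B..<B + k * q} a b + dev \<alpha> {B + k * q..<B + k * q + q} a b"
    by (simp only:) (rule dev_Un_disjoint, auto)
  with Suc abs_dev_complete_block[OF assms, of "B + k * q"] show ?case by simp
qed simp

text \<open>
  Dirichlet's theorem provides \<open>q \<le> N\<close> with \<open>\<bar>q \<alpha> - p\<bar> < 1 / N\<close>; the Diophantine condition bounds the
  number \<open>N div q\<close> of complete blocks by \<open>N\<^sup>\<gamma> / c\<close>, and the remainder \<open>N mod q\<close> is at most \<open>N / 2\<close>.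
\<close>

lemma abs_dev_consecutive:
  assumes c: "0 < c" and \<gamma>: "0 < \<gamma>"
    and dio: "\<And>(q::nat) (p::int). 1 \<le> q \<Longrightarrow> c * real q powr - (1 + \<gamma>) \<le> \<bar>real q * \<alpha> - p\<bar>"
    and ab: "0 \<le> a" "a \<le> b" "b \<le> 1"
  shows "\<bar>dev \<alpha> {B..<B + N} a b\<bar> \<le> 6 / (c * (1 - 2 powr - \<gamma>)) * real N powr \<gamma>"
proof (induction N arbitrary: B rule: less_induct)
  case (less N)
  \<comment> \<open>C solves \<open>C = 6 / c + C * 2 powr - \<gamma>\<close>: the complete blocks
    cost 6/c, and the remainder, at most half as long, costs the rest by induction.\<close>
  define C where "C = 6 / (c * (1 - 2 powr - \<gamma>))"
  have lt1: "2 powr - \<gamma> < 1" using \<gamma> by (simp add: powr_less_one)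
  have C0: "0 \<le> C" using c lt1 by (simp add: C_def)
  show ?case
  proof (cases "N = 0")
    case False
    then obtain p k where pk: "coprime p k" "0 < k" "k \<le> int N" "\<bar>of_int k * \<alpha> - of_int p\<bar> < 1 / N"
      using Dirichlet_approx_coprime[of N \<alpha>] by auto
    define q where "q = nat k"
    have k: "k = int q" using pk by (simp add: q_def)
    have q: "0 < q" "q \<le> N" and cop: "coprime p (int q)" and app: "\<bar>real q * \<alpha> - p\<bar> < 1 / N"
      using pk unfolding k by auto
    have "1 / real N \<le> 1 / real q" using q by (simp add: frac_le)
    then have app': "\<bar>real q * \<alpha> - p\<bar> \<le> 1 / q" using app by linarith
    define r where "r = N mod q"
    define d where "d = N div q"
    have N: "N = d * q + r" by (simp add: r_def d_def)
    have r: "r < q" using q by (simp add: r_def)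
    have "1 \<le> d" using q by (simp add: d_def div_greater_zero_iff Suc_le_eq)
    then have "q \<le> d * q" by simp
    then have "2 * r \<le> N" using r N by linarith
    have "c * real q powr - (1 + \<gamma>) < 1 / N"
      using dio[of q p] app q by linarith
    then have "c * N < real q powr (1 + \<gamma>)"
      unfolding powr_minus using False q by (simp add: field_simps)
    also have "\<dots> = q * real q powr \<gamma>" using q by (simp add: powr_add)
    also have "\<dots> \<le> q * real N powr \<gamma>" using q \<gamma> by (intro mult_left_mono powr_mono2) auto
    finally have "c * N \<le> q * real N powr \<gamma>" by simp
    moreover have "c * (real d * real q) \<le> c * N"
      using c N by (intro mult_left_mono) (auto simp flip: of_nat_mult)
    ultimately have "q * (c * d) \<le> q * real N powr \<gamma>" by (simp add: mult_ac)
    then have "c * d \<le> real N powr \<gamma>" using q by simp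
    then have d: "6 * real d \<le> 6 / c * real N powr \<gamma>" using c by (simp add: field_simps)
    have "{B..<B + N} = {B..<B + d * q} \<union> {B + d * q..<B + d * q + r}" using N by auto
    then have "dev \<alpha> {B..<B + N} a b
        = dev \<alpha> {B..<B + d * q} a b + dev \<alpha> {B + d * q..<B + d * q + r} a b"
      by (simp only:) (rule dev_Un_disjoint, auto)
    moreover have "\<bar>dev \<alpha> {B..<B + d * q} a b\<bar> \<le> 6 * real d"
      by (rule abs_dev_complete_blocks[OF q(1) cop app' ab])
    moreover have "\<bar>dev \<alpha> {B + d * q..<B + d * q + r} a b\<bar> \<le> C * real r powr \<gamma>"
      unfolding C_def using less q r by simp
    moreover have "C * real r powr \<gamma> \<le> C * (2 powr - \<gamma> * real N powr \<gamma>)"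
    proof -
      have "real r powr \<gamma> \<le> (real N / 2) powr \<gamma>"
        using \<open>2 * r \<le> N\<close> \<gamma> by (intro powr_mono2) auto
      also have "\<dots> = 2 powr - \<gamma> * real N powr \<gamma>"
        by (simp add: powr_divide powr_minus field_simps)
      finally show ?thesis using C0 by (rule mult_left_mono)
    qed
    moreover have "6 / c * real N powr \<gamma> + C * (2 powr - \<gamma> * real N powr \<gamma>) = C * real N powr \<gamma>"
    proof -
      have "6 / c = C * (1 - 2 powr - \<gamma>)" using \<gamma> c unfolding C_def by (simp add: divide_eq_eq eq_divide_eq)
      then show ?thesis by (simp only:) (simp add: algebra_simps)
    qed
    ultimately have "\<bar>dev \<alpha> {B..<B + N} a b\<bar> \<le> C * real N powr \<gamma>" using d by linarith
    then show ?thesis by (simp add: C_def)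
  qed simp
qed

section \<open>Metric Diophantine approximation\<close>

lemma AE_diophantine:
  assumes \<gamma>: "0 < \<gamma>"
  shows "AE \<alpha> in lebesgue. \<alpha> \<in> {0..<1} \<longrightarrow>
    (\<exists>c>0. \<forall>(q::nat) (p::int). 1 \<le> q \<longrightarrow> c * real q powr - (1 + \<gamma>) \<le> \<bar>real q * \<alpha> - p\<bar>)"
proof -
  \<comment> \<open>If the inequality with constant 1 fails for q and p, then \<alpha> lies in
    \<open>I q p\<close>. For \<alpha> in [0, 1) this forces p into {0..q}, so the bad set for q has
    measure of order \<open>q powr - (1 + \<gamma>)\<close>, which is summable.\<close>
  define I where "I q p = {(real p - real q powr - (1 + \<gamma>)) / q .. (real p + real q powr - (1 + \<gamma>)) / q}" for q p :: nat
  define A where "A q = (\<Union>p\<in>{..q}. I q p)" for q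
  have I: "I q p \<in> lmeasurable" for q p
    by (simp add: I_def)
  have A: "A q \<in> lmeasurable" for q
    unfolding A_def using I by (intro fmeasurable.finite_UN) auto
  have mA: "measure lebesgue (A q) \<le> 4 * real q powr - (1 + \<gamma>)" for q
  proof (cases "q = 0")
    \<comment> \<open>Division by zero yields zero, so \<open>I 0 p\<close> is the single point
      0.\<close>
    case True
    then show ?thesis by (simp add: A_def I_def)
  next
    case False
    have "measure lebesgue (A q) \<le> (\<Sum>p\<in>{..q}. measure lebesgue (I q p))"
      unfolding A_def using I by (intro measure_UNION_le) auto
    also have "\<dots> = (\<Sum>p\<in>{..q}. 2 * real q powr - (1 + \<gamma>) / q)"
      by (intro sum.cong refl) (simp add: I_def divide_right_mono flip: diff_divide_distrib)
    also have "\<dots> = ((real q + 1) / q) * (2 * real q powr - (1 + \<gamma>))"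
      by simp
    also have "\<dots> \<le> 2 * (2 * real q powr - (1 + \<gamma>))"
      using False by (intro mult_right_mono) (auto simp: field_simps)
    finally show ?thesis by simp
  qed
  have "summable (\<lambda>q. real q powr - (1 + \<gamma>))"
    using \<gamma> by (subst summable_real_powr_iff) auto
  then have "summable (\<lambda>q. measure lebesgue (A q))"
    using mA by - (rule summable_comparison_test'[OF summable_mult[where c = 4], where N = 0], auto)
  then have "AE \<alpha> in lebesgue. eventually (\<lambda>q. \<alpha> \<in> space lebesgue - A q) sequentially"
    using A by (intro borel_cantelli_AE1) (auto simp only: fmeasurable_def infinity_ennreal_def)
  then show ?thesis
  proof (eventually_elim, safe)
    fix \<alpha> :: real
    assume ev: "eventually (\<lambda>q. \<alpha> \<in> space lebesgue - A q) sequentially" and \<alpha>: "\<alpha> \<in> {0..<1}"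
    from ev obtain q1 where q1: "\<And>q. q1 \<le> q \<Longrightarrow> \<alpha> \<notin> A q"
      by (auto simp: eventually_sequentially)
    define Q where "Q = Suc q1"
    have large: "real q powr - (1 + \<gamma>) \<le> \<bar>real q * \<alpha> - p\<bar>" if "Q \<le> q" for q :: nat and p :: int
    proof (rule ccontr)
      assume "\<not> ?thesis"
      then have lt: "\<bar>real q * \<alpha> - p\<bar> < real q powr - (1 + \<gamma>)" by simp
      have q: "1 \<le> q" using that by (simp add: Q_def)
      have "real q powr - (1 + \<gamma>) \<le> real q powr 0"
        using q \<gamma> by (intro powr_mono) auto
      then have "\<bar>real q * \<alpha> - p\<bar> < 1" using lt q by simp
      moreover have "0 \<le> real q * \<alpha>" "real q * \<alpha> < real q * 1"
        using \<alpha> q by (auto intro!: mult_strict_left_mono)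
      ultimately have "-1 < real_of_int p" "real_of_int p < real q + 1" by linarith+
      then have p: "0 \<le> p" "p \<le> int q" by linarith+
      have "\<alpha> \<in> I q (nat p)"
        using lt p q by (auto simp: I_def field_simps)
      then have "\<alpha> \<in> A q" using p by (auto simp: A_def)
      then show False using q1[of q] that by (simp add: Q_def)
    qed
    \<comment> \<open>Multiplying by \<open>Q\<close> transfers the bound from large denominators to all denominators.\<close>
    define c where "c = real Q powr - (2 + \<gamma>)"
    have "c * real q powr - (1 + \<gamma>) \<le> \<bar>real q * \<alpha> - p\<bar>" if "1 \<le> q" for q :: nat and p :: int
    proof -
      have "real (Q * q) powr - (1 + \<gamma>) \<le> \<bar>real (Q * q) * \<alpha> - of_int (int Q * p)\<bar>"
        using that by (intro large) simp
      also have "\<dots> = real Q * \<bar>real q * \<alpha> - p\<bar>"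
      proof -
        have "real (Q * q) * \<alpha> - of_int (int Q * p) = real Q * (real q * \<alpha> - p)"
          by (simp add: algebra_simps)
        then show ?thesis by (simp only: abs_mult abs_of_nat)
      qed
      finally have "real Q powr - (1 + \<gamma>) * real q powr - (1 + \<gamma>) \<le> real Q * \<bar>real q * \<alpha> - p\<bar>"
        by (simp add: powr_mult)
      moreover have "real Q powr - (1 + \<gamma>) = real Q * c"
        unfolding c_def by (subst powr_mult_base) (auto simp: Q_def)
      ultimately have "real Q * (c * real q powr - (1 + \<gamma>)) \<le> real Q * \<bar>real q * \<alpha> - p\<bar>"
        by (simp add: mult_ac)
      then show ?thesis by (simp add: Q_def)
    qed
    moreover have "0 < c" by (simp add: c_def Q_def)
    ultimately show "\<exists>c>0. \<forall>(q::nat) (p::int). 1 \<le> q \<longrightarrow> c * real q powr - (1 + \<gamma>) \<le> \<bar>real q * \<alpha> - p\<bar>"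
      by blast
  qed
qed

section \<open>Independence of digits\<close>

text \<open>Counting measure on {0..<b^K} is the product measure on strings of K digits; the
  induction splits off the leading digit. The values lie in an arbitrary commutative ring because
  the identity serves twice: with reals for second moments, with polynomials as generating
  functions.\<close>

lemma sum_prod_digits:
  fixes f :: "nat \<Rightarrow> nat \<Rightarrow> 'a::comm_ring_1"
  assumes b: "0 < b"
  shows "(\<Sum>t<b ^ K. \<Prod>i<K. f i (t div b ^ i mod b)) = (\<Prod>i<K. \<Sum>d<b. f i d)"
proof (induction K)
  case (Suc K)
  have dig: "(d * b ^ K + t) div b ^ i mod b = t div b ^ i mod b" if "i < K" for d t i
  proof -
    have "d * b ^ K = (d * b ^ (K - Suc i) * b) * b ^ i"
      using that by (simp add: mult.assoc flip: power_Suc power_add)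
    then have "(d * b ^ K + t) div b ^ i = d * b ^ (K - Suc i) * b + t div b ^ i"
      using b by (simp only:) simp
    then show ?thesis by (simp only: mod_mult_self3)
  qed
  have shift: "sum g {d * b ^ K..<d * b ^ K + b ^ K} = (\<Sum>t<b ^ K. g (d * b ^ K + t))"
    for d and g :: "nat \<Rightarrow> 'a"
    using sum.shift_bounds_nat_ivl[of g 0 "d * b ^ K" "b ^ K"] by (simp add: atLeast0LessThan add.commute)
  have "(\<Sum>t<b ^ Suc K. \<Prod>i<Suc K. f i (t div b ^ i mod b))
      = (\<Sum>d<b. \<Sum>t<b ^ K. \<Prod>i<Suc K. f i ((d * b ^ K + t) div b ^ i mod b))"
    unfolding power_Suc sum.nat_group[symmetric] shift by simp
  also have "\<dots> = (\<Sum>d<b. \<Sum>t<b ^ K. (\<Prod>i<K. f i (t div b ^ i mod b)) * f K d)"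
    using b by (intro sum.cong refl) (simp add: dig)
  also have "\<dots> = (\<Prod>i<Suc K. \<Sum>d<b. f i d)"
    by (simp add: sum_distrib_left[symmetric] sum_distrib_right[symmetric] Suc.IH)
  finally show ?case .
qed simp

lemma sum_two_digits:
  fixes g :: "nat \<Rightarrow> real"
  assumes b: "0 < b" and ij: "i < K" "j < K" and g: "(\<Sum>d<b. g d) = 0"
  shows "(\<Sum>t<b ^ K. g (t div b ^ i mod b) * g (t div b ^ j mod b))
    = (if i = j then real b ^ (K - 1) * (\<Sum>d<b. (g d)\<^sup>2) else 0)"
proof -
  \<comment> \<open>A factor \<open>g\<close> at position i and another at position j: for i = j
    they meet and give a square, otherwise each is summed separately and vanishes.\<close>
  define f where "f k d = (if k = i then g d else 1) * (if k = j then g d else 1)" for k d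
  have "(\<Prod>k<K. f k (e k)) = g (e i) * g (e j)" for e
    using ij by (simp add: f_def prod.distrib prod.delta)
  then have "(\<Sum>t<b ^ K. g (t div b ^ i mod b) * g (t div b ^ j mod b)) = (\<Prod>k<K. \<Sum>d<b. f k d)"
    using sum_prod_digits[OF b, of f K] by simp
  also have "\<dots> = (if i = j then real b ^ (K - 1) * (\<Sum>d<b. (g d)\<^sup>2) else 0)"
  proof (cases "i = j")
    case True
    have "(\<Prod>k<K. \<Sum>d<b. f k d) = (\<Sum>d<b. f i d) * (\<Prod>k\<in>{..<K} - {i}. \<Sum>d<b. f k d)"
      using ij by (intro prod.remove) auto
    also have "(\<Prod>k\<in>{..<K} - {i}. \<Sum>d<b. f k d) = (\<Prod>k\<in>{..<K} - {i}. real b)"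
      using True by (intro prod.cong) (auto simp: f_def)
    finally show ?thesis using True ij by (simp add: f_def power2_eq_square)
  next
    case False
    have "(\<Sum>d<b. f i d) = 0" using False g by (simp add: f_def)
    then have "(\<Prod>k<K. \<Sum>d<b. f k d) = 0" using ij by (intro prod_zero) auto
    then show ?thesis using False by simp
  qed
  finally show ?thesis .
qed

text \<open>Centred functions of different digits are orthogonal, so only the diagonal survives. The
  injection \<rho> is there because the point with index i will read the digit at position M - 1 -
  i.\<close>

lemma second_moment_digits:
  fixes g :: "nat \<Rightarrow> real"
  assumes b: "0 < b" and I: "finite I" "inj_on \<rho> I" "\<rho> ` I \<subseteq> {..<K}" and g: "(\<Sum>d<b. g d) = 0"
  shows "(\<Sum>t<b ^ K. (\<Sum>i\<in>I. g (t div b ^ \<rho> i mod b))\<^sup>2)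
    = real (card I) * (real b ^ (K - 1) * (\<Sum>d<b. (g d)\<^sup>2))"
proof -
  have "(\<Sum>t<b ^ K. (\<Sum>i\<in>I. g (t div b ^ \<rho> i mod b))\<^sup>2)
      = (\<Sum>t<b ^ K. \<Sum>i\<in>I. \<Sum>j\<in>I. g (t div b ^ \<rho> i mod b) * g (t div b ^ \<rho> j mod b))"
    by (simp add: power2_eq_square sum_product)
  also have "\<dots> = (\<Sum>i\<in>I. \<Sum>t<b ^ K. \<Sum>j\<in>I. g (t div b ^ \<rho> i mod b) * g (t div b ^ \<rho> j mod b))"
    by (rule sum.swap)
  also have "\<dots> = (\<Sum>i\<in>I. \<Sum>j\<in>I. \<Sum>t<b ^ K. g (t div b ^ \<rho> i mod b) * g (t div b ^ \<rho> j mod b))"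
    by (intro sum.cong refl sum.swap)
  also have "\<dots> = (\<Sum>i\<in>I. \<Sum>j\<in>I. if i = j then real b ^ (K - 1) * (\<Sum>d<b. (g d)\<^sup>2) else 0)"
  proof (intro sum.cong refl)
    fix i j assume ij: "i \<in> I" "j \<in> I"
    then have "\<rho> i < K" "\<rho> j < K" "\<rho> i = \<rho> j \<longleftrightarrow> i = j"
      using I by (auto simp: inj_on_def)
    then show "(\<Sum>t<b ^ K. g (t div b ^ \<rho> i mod b) * g (t div b ^ \<rho> j mod b))
        = (if i = j then real b ^ (K - 1) * (\<Sum>d<b. (g d)\<^sup>2) else 0)"
      using sum_two_digits[OF b _ _ g] by simp
  qed
  also have "\<dots> = real (card I) * (real b ^ (K - 1) * (\<Sum>d<b. (g d)\<^sup>2))"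
    using I by (simp add: sum.delta)
  finally show ?thesis .
qed

text \<open>Chebyshev's inequality, with the variance p (1 - p) of one digit bounded by p. Keeping p
  makes the bound proportional to the area of the rectangle of indices and digits, so that summing
  over a partition into rectangles costs no more than the whole.\<close>

lemma card_large_digit_deviation:
  assumes b: "0 < b" and K: "0 < K" and I: "finite I" "inj_on \<rho> I" "\<rho> ` I \<subseteq> {..<K}"
    and xy: "x \<le> y" "y \<le> b" and \<mu>: "0 < \<mu>"
  shows "real (card {t \<in> {..<b ^ K}. \<mu> < \<bar>\<Sum>i\<in>I. indicator {x..<y} (t div b ^ \<rho> i mod b) - (real y - real x) / b\<bar>})
    \<le> real b ^ K * (card I * ((real y - real x) / b)) / \<mu>\<^sup>2" (is "real (card ?T) \<le> _")
proof -
  define p where "p = (real y - real x) / b"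
  define g where "g d = indicator {x..<y} d - p" for d
  have "{..<b} \<inter> {d. x \<le> d \<and> d < y} = {x..<y}" using xy by auto
  then have ind: "(\<Sum>d<b. indicator {x..<y} d) = real y - real x"
    using xy by (simp add: indicator_def sum.If_cases of_nat_diff)
  have bp: "real b * p = real y - real x" using b by (simp add: p_def)
  have g0: "(\<Sum>d<b. g d) = 0"
    by (simp add: g_def sum_subtractf ind bp)
  have "(g d)\<^sup>2 = (1 - 2 * p) * indicator {x..<y} d + p\<^sup>2" for d
    by (simp add: g_def indicator_def power2_eq_square algebra_simps)
  then have "(\<Sum>d<b. (g d)\<^sup>2) = (1 - 2 * p) * (real b * p) + real b * p\<^sup>2"
    by (simp add: sum.distrib sum_distrib_left[symmetric] ind bp)
  also have "\<dots> \<le> real b * p"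
    using mult_nonneg_nonneg[of "real b" "p\<^sup>2"] by (simp add: power2_eq_square algebra_simps)
  finally have g2: "(\<Sum>d<b. (g d)\<^sup>2) \<le> real b * p" .
  have "real (card ?T) * \<mu>\<^sup>2 = (\<Sum>t\<in>?T. \<mu>\<^sup>2)" by simp
  also have "\<dots> \<le> (\<Sum>t\<in>?T. (\<Sum>i\<in>I. g (t div b ^ \<rho> i mod b))\<^sup>2)"
  proof (rule sum_mono)
    fix t assume "t \<in> ?T"
    then have "\<mu> \<le> \<bar>\<Sum>i\<in>I. g (t div b ^ \<rho> i mod b)\<bar>" by (simp add: g_def p_def)
    then have "\<mu>\<^sup>2 \<le> \<bar>\<Sum>i\<in>I. g (t div b ^ \<rho> i mod b)\<bar>\<^sup>2" using \<mu> by (intro power_mono) auto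
    then show "\<mu>\<^sup>2 \<le> (\<Sum>i\<in>I. g (t div b ^ \<rho> i mod b))\<^sup>2" by simp
  qed
  also have "\<dots> \<le> (\<Sum>t<b ^ K. (\<Sum>i\<in>I. g (t div b ^ \<rho> i mod b))\<^sup>2)"
    by (intro sum_mono2) auto
  also have "\<dots> = real (card I) * (real b ^ (K - 1) * (\<Sum>d<b. (g d)\<^sup>2))"
    by (rule second_moment_digits[OF b I g0])
  also have "\<dots> \<le> real (card I) * (real b ^ (K - 1) * (real b * p))"
    using g2 by (intro mult_left_mono) auto
  also have "real b ^ (K - 1) * (real b * p) = real b ^ K * p"
    using K by (cases K) auto
  finally show ?thesis
    using \<mu> by (simp add: p_def[symmetric] pos_le_divide_eq mult_ac)
qed

section \<open>Distribution of a digit count, and central binomial coefficients\<close>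

lemma coeff_one_plus_X_power: "coeff ([:1, 1:] ^ n) r = real (n choose r)"
  by (cases "r \<le> n") (simp_all add: coeff_linear_poly_power coeff_eq_0 degree_linear_power)

text \<open>Mark each digit below h at a position in I by the indeterminate X. Exactly half of the
  2h digits are marked, so a position in I contributes h (1 + X) and any other position 2h; the
  count is the coefficient of X^r in the product.\<close>

lemma card_digit_count_eq:
  assumes h: "0 < h" and I: "I \<subseteq> {..<K}"
  shows "real (card {t \<in> {..<(2 * h) ^ K}. card {i \<in> I. t div (2 * h) ^ i mod (2 * h) < h} = r})
    = real (2 * h) ^ K * real (card I choose r) / 2 ^ card I"
proof -
  define b where "b = 2 * h"
  have b: "0 < b" using h by (simp add: b_def)
  have fin: "finite I" using I finite_subset by blast
  define c where "c t = card {i \<in> I. t div b ^ i mod b < h}" for t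
  define f :: "nat \<Rightarrow> nat \<Rightarrow> real poly" where "f i d = (if i \<in> I \<and> d < h then monom 1 1 else 1)" for i d
  have L: "(\<Prod>i<K. f i (t div b ^ i mod b)) = monom 1 (c t)" for t
  proof -
    have "(\<Prod>i<K. f i (t div b ^ i mod b)) = (\<Prod>i\<in>{i \<in> I. t div b ^ i mod b < h}. monom 1 1)"
      using I by (intro prod.mono_neutral_cong_right) (auto simp: f_def)
    then show ?thesis by (simp add: c_def monom_power)
  qed
  have fsum: "(\<Sum>d<b. f i d) = (if i \<in> I then smult (real h) [:1, 1:] else [:real b:])" for i
  proof -
    have "{..<b} \<inter> {d. d < h} = {..<h}" "{..<b} \<inter> - {d. d < h} = {h..<b}" by (auto simp: b_def)
    then have "(\<Sum>d<b. if d < h then monom 1 1 else 1) = of_nat h * (monom 1 1 :: real poly) + of_nat h"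
      by (simp add: sum.If_cases b_def)
    then show ?thesis
      by (simp add: f_def of_nat_poly monom_altdef)
  qed
  have "(\<Sum>t<b ^ K. monom 1 (c t)) = (\<Prod>i<K. if i \<in> I then smult (real h) [:1, 1:] else [:real b:])"
    using sum_prod_digits[OF b, of f K] by (simp only: L fsum)
  also have "\<dots> = (\<Prod>i\<in>I. smult (real h) [:1, 1:]) * (\<Prod>i\<in>{..<K} - I. [:real b:])"
    using I by (simp add: prod.If_cases Int_absorb1 Diff_eq)
  also have "\<dots> = smult (real h ^ card I * real b ^ (K - card I)) ([:1, 1:] ^ card I)"
    using I fin by (simp add: card_Diff_subset smult_power poly_const_pow mult_ac del: smult_pCons)
  finally have "coeff (\<Sum>t<b ^ K. monom 1 (c t)) r = real h ^ card I * real b ^ (K - card I) * real (card I choose r)"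
    by (simp add: coeff_one_plus_X_power)
  moreover have "coeff (\<Sum>t<b ^ K. monom 1 (c t)) r = real (card {t \<in> {..<b ^ K}. c t = r})"
  proof -
    have "coeff (\<Sum>t<b ^ K. monom 1 (c t)) r = (\<Sum>t<b ^ K. if c t = r then 1 else (0::real))"
      by (simp add: coeff_sum)
    also have "\<dots> = real (card {t \<in> {..<b ^ K}. c t = r})"
      by (simp add: sum.If_cases Int_def)
    finally show ?thesis .
  qed
  moreover have "real h ^ card I * real b ^ (K - card I) = real b ^ K / 2 ^ card I"
  proof -
    have "card I \<le> K" using I card_mono[OF finite_lessThan I] by simp
    then have "real b ^ K = real b ^ card I * real b ^ (K - card I)" by (simp flip: power_add)
    then show ?thesis by (simp add: b_def power_mult_distrib)
  qed
  ultimately show ?thesis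
    by (simp add: c_def b_def)
qed

text \<open>After squaring, the induction step follows from C(2n+2, n+1) = 2 (2n+1) C(2n, n) / (n+1)
  and (2n+1) (2n+3) \<le> (2n+2)^2.\<close>

lemma central_binomial_upper: "real ((2 * n) choose n) * sqrt (real (2 * n + 1)) \<le> 4 ^ n"
proof -
  have "(real ((2 * n) choose n))\<^sup>2 * real (2 * n + 1) \<le> 16 ^ n"
  proof (induction n)
    case (Suc n)
    have "Suc n * ((2 * Suc n) choose Suc n) = 2 * Suc n * (Suc (2 * n) choose n)"
      using Suc_times_binomial[of n "Suc (2 * n)"] by simp
    also have "Suc (2 * n) choose n = Suc (2 * n) choose Suc n"
      by (subst binomial_symmetric) auto
    also have "2 * Suc n * (Suc (2 * n) choose Suc n) = 2 * (2 * n + 1) * ((2 * n) choose n)"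
      using Suc_times_binomial[of n "2 * n"] by simp
    finally have "Suc n * ((2 * Suc n) choose Suc n) = 2 * (2 * n + 1) * ((2 * n) choose n)" .
    then have e: "real (Suc n) * real ((2 * Suc n) choose Suc n) = 2 * real (2 * n + 1) * real ((2 * n) choose n)"
      by (metis of_nat_mult of_nat_numeral)
    have "(real (Suc n))\<^sup>2 * ((real ((2 * Suc n) choose Suc n))\<^sup>2 * real (2 * Suc n + 1))
        = (real (Suc n) * real ((2 * Suc n) choose Suc n))\<^sup>2 * real (2 * Suc n + 1)"
      by (simp add: power_mult_distrib)
    also have "\<dots> = (4 * real (2 * n + 1) * real (2 * Suc n + 1)) * ((real ((2 * n) choose n))\<^sup>2 * real (2 * n + 1))"
      unfolding e by (simp add: power2_eq_square algebra_simps)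
    also have "\<dots> \<le> (4 * real (2 * n + 1) * real (2 * Suc n + 1)) * 16 ^ n"
      using Suc.IH by (intro mult_left_mono) auto
    also have "\<dots> \<le> (16 * (real (Suc n))\<^sup>2) * 16 ^ n"
      by (intro mult_right_mono) (auto simp: power2_eq_square algebra_simps)
    finally have "(real (Suc n))\<^sup>2 * ((real ((2 * Suc n) choose Suc n))\<^sup>2 * real (2 * Suc n + 1))
        \<le> (real (Suc n))\<^sup>2 * 16 ^ Suc n" by (simp add: mult_ac)
    then show ?case by (rule mult_left_le_imp_le) simp
  qed simp
  also have "(16::real) ^ n = (4 ^ n)\<^sup>2" by (simp add: power2_eq_square flip: power_mult_distrib)
  finally have "(real ((2 * n) choose n) * sqrt (real (2 * n + 1)))\<^sup>2 \<le> (4 ^ n)\<^sup>2"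
    by (simp add: power_mult_distrib)
  then show ?thesis by (rule power2_le_imp_le) simp
qed

text \<open>A prefix is a disjoint union of at most one dyadic block for each of the m + 1 scales.
  This replaces all prefixes by few blocks, which a union bound can afford.\<close>

lemma dyadic_prefix_bound:
  fixes \<phi> :: "nat \<Rightarrow> nat \<Rightarrow> real"
  assumes add: "\<And>x y z. x \<le> y \<Longrightarrow> y \<le> z \<Longrightarrow> \<phi> x z = \<phi> x y + \<phi> y z"
    and bnd: "\<And>r v. r \<le> m \<Longrightarrow> v < 2 ^ (m - r) \<Longrightarrow> \<bar>\<phi> (v * 2 ^ r) ((v + 1) * 2 ^ r)\<bar> \<le> \<mu>"
    and n: "n \<le> 2 ^ m"
  shows "\<bar>\<phi> 0 n\<bar> \<le> (real m + 1) * \<mu>"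
proof -
  have "0 \<le> \<mu>" using bnd[of 0 0] by (simp add: order_trans[OF abs_ge_zero])
  have "\<bar>\<phi> (v * 2 ^ r) k\<bar> \<le> (real r + 1) * \<mu>"
    if "r \<le> m" "v < 2 ^ (m - r)" "v * 2 ^ r \<le> k" "k \<le> (v + 1) * 2 ^ r" for r v k
    using that
  proof (induction r arbitrary: v)
    case 0
    then consider "k = v" | "k = v + 1" by fastforce
    then show ?case
    proof cases
      case 1
      \<comment> \<open>Additivity with equal endpoints gives \<open>\<phi> v v = 0\<close>.\<close>
      then show ?thesis using add[of v v v] \<open>0 \<le> \<mu>\<close> by simp
    next
      case 2
      then show ?thesis using bnd[of 0 v] 0 by simp
    qed
  next
    case (Suc r)
    have "(2::nat) ^ (m - r) = 2 * 2 ^ (m - Suc r)" using Suc.prems by (simp add: Suc_diff_Suc flip: power_Suc)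
    then have v: "2 * v < 2 ^ (m - r)" "2 * v + 1 < 2 ^ (m - r)" using Suc.prems by auto
    have low: "v * 2 ^ Suc r = 2 * v * 2 ^ r" by simp
    show ?case
    proof (cases "k \<le> (2 * v + 1) * 2 ^ r")
      case True
      then have "\<bar>\<phi> (2 * v * 2 ^ r) k\<bar> \<le> (real r + 1) * \<mu>"
        using Suc.prems v by (intro Suc.IH) auto
      also have "\<dots> \<le> (real (Suc r) + 1) * \<mu>" using \<open>0 \<le> \<mu>\<close> by (intro mult_right_mono) auto
      finally show ?thesis unfolding low .
    next
      case False
      have "\<phi> (2 * v * 2 ^ r) k = \<phi> (2 * v * 2 ^ r) ((2 * v + 1) * 2 ^ r) + \<phi> ((2 * v + 1) * 2 ^ r) k"
        using False by (intro add) auto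
      moreover have "\<bar>\<phi> (2 * v * 2 ^ r) ((2 * v + 1) * 2 ^ r)\<bar> \<le> \<mu>"
        using Suc.prems v by (intro bnd) auto
      moreover have "\<bar>\<phi> ((2 * v + 1) * 2 ^ r) k\<bar> \<le> (real r + 1) * \<mu>"
        using Suc.prems v False by (intro Suc.IH) auto
      ultimately show ?thesis unfolding low by (simp add: algebra_simps)
    qed
  qed
  from this[of m 0 n] n show ?thesis by simp
qed

section \<open>Blocks of powers\<close>

text \<open>Turns counts of bad integers into statements for almost all \<alpha>: each t accounts
  for an interval of length 1 / N m, so the bad set at m has measure at most s m, and Borel-Cantelli
  applies.\<close>

lemma AE_eventually_floor_notin:
  fixes N :: "nat \<Rightarrow> nat" and G :: "nat \<Rightarrow> nat set" and s :: "nat \<Rightarrow> real"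
  assumes N: "\<And>m. 0 < N m" and G: "\<And>m. finite (G m)"
    and le: "\<And>m. real (card (G m)) \<le> N m * s m" and s: "summable s"
  shows "AE \<alpha> in lebesgue. 0 \<le> \<alpha> \<longrightarrow> (\<forall>\<^sub>F m in sequentially. nat \<lfloor>real (N m) * \<alpha>\<rfloor> \<notin> G m)"
proof -
  define I where "I m t = {real t / N m .. (real t + 1) / N m}" for m t
  define A where "A m = (\<Union>t\<in>G m. I m t)" for m
  have I: "I m t \<in> lmeasurable" for m t by (simp add: I_def)
  have A: "A m \<in> lmeasurable" for m
    unfolding A_def using I G by (intro fmeasurable.finite_UN) auto
  have mA: "measure lebesgue (A m) \<le> s m" for m
  proof -
    have "measure lebesgue (A m) \<le> (\<Sum>t\<in>G m. measure lebesgue (I m t))"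
      unfolding A_def using I G by (intro measure_UNION_le) auto
    also have "\<dots> = (\<Sum>t\<in>G m. 1 / N m)"
      using N by (intro sum.cong refl) (simp add: I_def divide_right_mono flip: diff_divide_distrib)
    also have "\<dots> \<le> s m" using le[of m] N[of m] by (simp add: field_simps)
    finally show ?thesis .
  qed
  have "summable (\<lambda>m. measure lebesgue (A m))"
    using mA by (intro summable_comparison_test'[OF s, where N = 0]) auto
  then have "AE \<alpha> in lebesgue. eventually (\<lambda>m. \<alpha> \<in> space lebesgue - A m) sequentially"
    using A by (intro borel_cantelli_AE1) (auto simp only: fmeasurable_def infinity_ennreal_def)
  then show ?thesis
  proof (eventually_elim, safe)
    fix \<alpha> :: real
    assume ev: "eventually (\<lambda>m. \<alpha> \<in> space lebesgue - A m) sequentially" and \<alpha>: "0 \<le> \<alpha>"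
    from ev show "\<forall>\<^sub>F m in sequentially. nat \<lfloor>real (N m) * \<alpha>\<rfloor> \<notin> G m"
    proof eventually_elim
      case (elim m)
      show ?case
      proof
        assume t: "nat \<lfloor>real (N m) * \<alpha>\<rfloor> \<in> G m"
        have "real (nat \<lfloor>real (N m) * \<alpha>\<rfloor>) = of_int \<lfloor>real (N m) * \<alpha>\<rfloor>" using \<alpha> by simp
        then have "\<alpha> \<in> I m (nat \<lfloor>real (N m) * \<alpha>\<rfloor>)"
          unfolding I_def using N[of m] by (simp add: field_simps) linarith
        then show False using t elim by (auto simp: A_def)
      qed
    qed
  qed
qed

text \<open>With \<open>x = b ^ (J + i) * \<alpha>\<close> one has \<lfloor>b frac x\<rfloor> =
  \<lfloor>b x\<rfloor> mod b, and \<lfloor>b x\<rfloor> is a quotient of \<lfloor>b^(J+M)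
  \<alpha>\<rfloor> because nested floors of divisions collapse. A single integer thus encodes the
  leading digits of all M points, in reversed order.\<close>

lemma digit_of_frac:
  assumes b: "0 < b" and \<alpha>: "0 \<le> \<alpha>" and i: "i < M"
  shows "nat \<lfloor>real b * frac (real (b ^ (J + i)) * \<alpha>)\<rfloor>
    = nat \<lfloor>real (b ^ (J + M)) * \<alpha>\<rfloor> div b ^ (M - 1 - i) mod b"
proof -
  define x where "x = real (b ^ (J + i)) * \<alpha>"
  define y where "y = real (b ^ (J + M)) * \<alpha>"
  have x0: "0 \<le> y" using \<alpha> by (simp add: y_def)
  have "J + M = Suc (J + i) + (M - 1 - i)" using i by simp
  then have "b ^ (J + M) = b * b ^ (J + i) * b ^ (M - 1 - i)" by (simp only: power_add power_Suc)
  then have "y = real b * x * real_of_int (int b ^ (M - 1 - i))" by (simp add: x_def y_def)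
  then have bx: "real b * x = y / real_of_int (int b ^ (M - 1 - i))" using b by simp
  have fbx: "\<lfloor>real b * x\<rfloor> = \<lfloor>y\<rfloor> div int b ^ (M - 1 - i)"
    unfolding bx by (rule floor_divide_real_eq_div) simp
  have "\<lfloor>x\<rfloor> = \<lfloor>real b * x / real_of_int (int b)\<rfloor>" using b by simp
  also have "\<dots> = \<lfloor>real b * x\<rfloor> div int b" by (rule floor_divide_real_eq_div) simp
  finally have fx: "\<lfloor>x\<rfloor> = \<lfloor>real b * x\<rfloor> div int b" .
  have "real b * frac x = real b * x - of_int (int b * \<lfloor>x\<rfloor>)" by (simp add: frac_def algebra_simps)
  then have "\<lfloor>real b * frac x\<rfloor> = \<lfloor>real b * x\<rfloor> - int b * \<lfloor>x\<rfloor>" by (simp only: floor_diff_of_int)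
  also have "\<dots> = \<lfloor>real b * x\<rfloor> mod int b" unfolding fx by (rule minus_mult_div_eq_mod)
  finally have "nat \<lfloor>real b * frac x\<rfloor> = nat (\<lfloor>y\<rfloor> div int b ^ (M - 1 - i) mod int b)"
    by (simp add: fbx)
  also have "\<dots> = nat \<lfloor>y\<rfloor> div b ^ (M - 1 - i) mod b"
  proof -
    have "\<lfloor>y\<rfloor> = int (nat \<lfloor>y\<rfloor>)" using x0 by simp
    then have "\<lfloor>y\<rfloor> div int b ^ (M - 1 - i) mod int b = int (nat \<lfloor>y\<rfloor> div b ^ (M - 1 - i) mod b)"
      by (metis of_nat_power zdiv_int zmod_int)
    then show ?thesis by simp
  qed
  finally show ?thesis by (simp add: x_def y_def)
qed

definition chunk :: "nat \<Rightarrow> nat \<Rightarrow> nat \<Rightarrow> nat set" where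
  "chunk b J n = (\<lambda>i. b ^ (J + i)) ` {..<n}"

lemma inj_chunk: "2 \<le> (b::nat) \<Longrightarrow> inj_on (\<lambda>i. b ^ (J + i)) A"
  by (auto simp: inj_on_def)

lemma finite_chunk [simp]: "finite (chunk b J n)"
  by (simp add: chunk_def)

lemma card_chunk: "2 \<le> b \<Longrightarrow> card (chunk b J n) = n"
  by (simp add: chunk_def card_image inj_chunk)

text \<open>Rounding [a, c) outwards to multiples of 1/b costs at most 2/b per point, hence at most
  2 in all since n \<le> b. The rounded interval is a difference of two digit prefixes, which gives
  2E, and the one-sided bound is then doubled.\<close>

lemma abs_dev_chunk_le:
  fixes b J n :: nat
  defines "X \<equiv> \<lambda>\<alpha> i. nat \<lfloor>real b * frac (real (b ^ (J + i)) * \<alpha>)\<rfloor>"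
  assumes b: "2 \<le> b" "n \<le> b"
    and E: "\<And>v. v \<le> b \<Longrightarrow> \<bar>\<Sum>i<n. indicator {0..<v} (X \<alpha> i) - real v / b\<bar> \<le> E"
    and ac: "0 \<le> a" "a \<le> c" "c \<le> 1"
  shows "\<bar>dev \<alpha> (chunk b J n) a c\<bar> \<le> 4 * E + 4"
proof -
  have "dev \<alpha> (chunk b J n) a c \<le> 2 * E + 2" if ac: "0 \<le> a" "a \<le> c" "c \<le> 1" for a c
  proof -
    define u where "u = nat \<lfloor>a * b\<rfloor>"
    define v where "v = nat \<lceil>c * b\<rceil>"
    have "a * b \<le> c * b" "c * b \<le> 1 * real b" using ac by (intro mult_right_mono; simp)+
    then have c_le: "\<lceil>c * b\<rceil> \<le> int b" and "\<lfloor>a * b\<rfloor> \<le> \<lceil>c * b\<rceil>" by linarith+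
    then have uv: "u \<le> v" "v \<le> b" "u \<le> b" unfolding u_def v_def by (auto simp only: nat_mono nat_le_iff intro: order_trans)
    have "0 \<le> a * b" "0 \<le> c * b" using ac by auto
    then have u: "real u \<le> a * b" "a * b < real u + 1" and v: "c * b \<le> real v" "real v < c * b + 1"
      unfolding u_def v_def by (simp_all add: of_nat_nat) linarith+
    have step: "indicator {a..<c} (frac (real (b ^ (J + i)) * \<alpha>)) - (c - a)
        \<le> (indicator {0..<v} (X \<alpha> i) - real v / b) - (indicator {0..<u} (X \<alpha> i) - real u / b) + 2 / b" for i
    proof -
      define f where "f = frac (real (b ^ (J + i)) * \<alpha>)"
      have X: "X \<alpha> i = nat \<lfloor>real b * f\<rfloor>" by (simp add: X_def f_def)
      have "u \<le> X \<alpha> i \<and> X \<alpha> i < v" if "a \<le> f" "f < c"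
      proof -
        have ab: "a * b \<le> real b * f" "real b * f < c * b" using that b by (auto simp: mult.commute)
        then have "\<lfloor>a * b\<rfloor> \<le> \<lfloor>real b * f\<rfloor>" "\<lfloor>real b * f\<rfloor> < \<lceil>c * b\<rceil>" "0 \<le> \<lfloor>real b * f\<rfloor>"
          using \<open>0 \<le> a * b\<close> by (auto simp: floor_mono) linarith+
        then show ?thesis unfolding X u_def v_def
          by (metis dual_order.strict_trans1 nat_less_eq_zless nat_mono)
      qed
      then have "indicator {a..<c} f \<le> (indicator {0..<v} (X \<alpha> i) - indicator {0..<u} (X \<alpha> i) :: real)"
        using uv by (auto simp: indicator_def)
      moreover have "real v / b - real u / b \<le> (c - a) + 2 / b"
      proof -
        have "(real v - real u) / b \<le> ((c - a) * b + 2) / b"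
          using u v by (intro divide_right_mono) (auto simp: algebra_simps)
        then show ?thesis using b by (simp add: diff_divide_distrib add_divide_distrib)
      qed
      ultimately show ?thesis unfolding f_def by linarith
    qed
    have "dev \<alpha> (chunk b J n) a c = (\<Sum>i<n. indicator {a..<c} (frac (real (b ^ (J + i)) * \<alpha>)) - (c - a))"
      unfolding dev_def chunk_def by (subst sum.reindex) (use b in \<open>auto simp: inj_chunk\<close>)
    also have "\<dots> \<le> (\<Sum>i<n. (indicator {0..<v} (X \<alpha> i) - real v / b) - (indicator {0..<u} (X \<alpha> i) - real u / b) + 2 / b)"
      by (intro sum_mono step)
    also have "\<dots> = (\<Sum>i<n. indicator {0..<v} (X \<alpha> i) - real v / b)
        - (\<Sum>i<n. indicator {0..<u} (X \<alpha> i) - real u / b) + n * (2 / b)"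
      by (simp only: sum.distrib sum_subtractf sum_constant card_lessThan)
    also have "\<dots> \<le> E + E + 2"
    proof -
      have "n * (2 / real b) \<le> 2" using b by (simp add: field_simps)
      then show ?thesis using E[OF uv(2)] E[OF uv(3)] by linarith
    qed
    finally show ?thesis by simp
  qed
  from abs_dev_le_of_upper[OF this ac] show ?thesis by simp
qed

section \<open>Upper bound for blocks of powers\<close>

definition digit_dev :: "nat \<Rightarrow> nat \<Rightarrow> nat \<Rightarrow> nat \<Rightarrow> nat \<Rightarrow> nat \<Rightarrow> nat \<Rightarrow> real" where
  "digit_dev b M t x y x' y' =
    (\<Sum>i\<in>{x..<y}. indicator {x'..<y'} (t div b ^ (M - 1 - i) mod b) - (real y' - real x') / real b)"

text \<open>\<open>digit_dev\<close> is additive in the index range and in the digit range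
  separately. Decomposing first one and then the other splits [0, n) x [0, k) into at most (m + 1)
  (S + 1) dyadic rectangles.\<close>

lemma abs_digit_dev_le:
  assumes rect: "\<And>r v s u. r \<le> m \<Longrightarrow> v < 2 ^ (m - r) \<Longrightarrow> s \<le> S \<Longrightarrow> u < 2 ^ (S - s) \<Longrightarrow>
      \<bar>digit_dev b M t (v * 2 ^ r) ((v + 1) * 2 ^ r) (u * 2 ^ s) ((u + 1) * 2 ^ s)\<bar> \<le> \<mu>"
    and n: "n \<le> 2 ^ m" and k: "k \<le> 2 ^ S"
  shows "\<bar>digit_dev b M t 0 n 0 k\<bar> \<le> (real m + 1) * ((real S + 1) * \<mu>)"
proof (rule dyadic_prefix_bound[where \<phi> = "\<lambda>x y. digit_dev b M t x y 0 k", OF _ _ n])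
  fix x y z :: nat assume "x \<le> y" "y \<le> z"
  then show "digit_dev b M t x z 0 k = digit_dev b M t x y 0 k + digit_dev b M t y z 0 k"
    unfolding digit_dev_def by (rule sum.atLeastLessThan_concat[symmetric])
next
  fix r v :: nat assume rv: "r \<le> m" "v < 2 ^ (m - r)"
  show "\<bar>digit_dev b M t (v * 2 ^ r) ((v + 1) * 2 ^ r) 0 k\<bar> \<le> (real S + 1) * \<mu>"
  proof (rule dyadic_prefix_bound[where \<phi> = "digit_dev b M t (v * 2 ^ r) ((v + 1) * 2 ^ r)", OF _ _ k])
    fix x y z :: nat assume "x \<le> y" "y \<le> z"
    then show "digit_dev b M t (v * 2 ^ r) ((v + 1) * 2 ^ r) x z
        = digit_dev b M t (v * 2 ^ r) ((v + 1) * 2 ^ r) x y + digit_dev b M t (v * 2 ^ r) ((v + 1) * 2 ^ r) y z"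
      unfolding digit_dev_def sum.distrib[symmetric]
      by (intro sum.cong refl) (auto simp: indicator_def diff_divide_distrib)
  next
    fix s u :: nat assume "s \<le> S" "u < 2 ^ (S - s)"
    then show "\<bar>digit_dev b M t (v * 2 ^ r) ((v + 1) * 2 ^ r) (u * 2 ^ s) ((u + 1) * 2 ^ s)\<bar> \<le> \<mu>"
      by (rule rect[OF rv])
  qed
qed

text \<open>For fixed scales r and s the rectangles have total area \<open>2 ^ m * b\<close>, so
  together they fail with probability at most 2^m / \<mu>^2 = 1 / (m + 2)^4. There are (m + 1) (m +
  2) pairs of scales; the factor (m + 2)^2 in \<mu> is chosen so that a summable bound
  remains.\<close>

lemma card_exceptional_digits:
  fixes m J :: nat
  defines "b \<equiv> 2 ^ Suc m" and "M \<equiv> 2 ^ m"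
  defines "\<mu> \<equiv> sqrt (2 ^ m) * (real m + 2)\<^sup>2"
  shows "real (card {t \<in> {..<b ^ (J + M)}. \<exists>r\<le>m. \<exists>s\<le>Suc m. \<exists>v<2 ^ (m - r). \<exists>u<2 ^ (Suc m - s).
      \<mu> < \<bar>digit_dev b M t (v * 2 ^ r) ((v + 1) * 2 ^ r) (u * 2 ^ s) ((u + 1) * 2 ^ s)\<bar>})
    \<le> real (b ^ (J + M)) * (1 / (real m + 2)\<^sup>2)" (is "real (card ?G) \<le> _")
proof -
  define K where "K = J + M"
  define T where "T r s v u = {t \<in> {..<b ^ K}.
      \<mu> < \<bar>digit_dev b M t (v * 2 ^ r) ((v + 1) * 2 ^ r) (u * 2 ^ s) ((u + 1) * 2 ^ s)\<bar>}" for r s v u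
  have b: "0 < b" and K: "0 < K" and \<mu>: "0 < \<mu>" by (auto simp: b_def K_def M_def \<mu>_def)
  have \<mu>2: "\<mu>\<^sup>2 = 2 ^ m * (real m + 2) ^ 4" by (simp add: \<mu>_def power_mult_distrib flip: power_mult)
  have T: "real (card (T r s v u)) \<le> real b ^ K * (2 ^ r * (2 ^ s / b)) / \<mu>\<^sup>2"
    if "r \<le> m" "s \<le> Suc m" "v < 2 ^ (m - r)" "u < 2 ^ (Suc m - s)" for r s v u
  proof -
    have "(v + 1) * 2 ^ r \<le> 2 ^ (m - r) * 2 ^ r" using that by (intro mult_right_mono) auto
    then have vM: "(v + 1) * 2 ^ r \<le> M" using that by (simp add: M_def flip: power_add)
    have "(u + 1) * 2 ^ s \<le> 2 ^ (Suc m - s) * 2 ^ s" using that by (intro mult_right_mono) auto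
    then have ub: "(u + 1) * 2 ^ s \<le> b" using that by (simp add: b_def del: power_Suc flip: power_add)
    have inj: "inj_on (\<lambda>i. M - 1 - i) {v * 2 ^ r..<(v + 1) * 2 ^ r}"
      using vM by (auto simp: inj_on_def)
    have img: "(\<lambda>i. M - 1 - i) ` {v * 2 ^ r..<(v + 1) * 2 ^ r} \<subseteq> {..<K}"
      using vM by (auto simp: K_def)
    show ?thesis
      using card_large_digit_deviation[OF b K _ inj img _ ub \<mu>, of "u * 2 ^ s"]
      unfolding T_def digit_dev_def by (simp add: algebra_simps)
  qed
  have "?G \<subseteq> (\<Union>r\<in>{..m}. \<Union>s\<in>{..Suc m}. \<Union>v\<in>{..<2 ^ (m - r)}. \<Union>u\<in>{..<2 ^ (Suc m - s)}. T r s v u)"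
    unfolding T_def K_def by blast
  then have "card ?G \<le> card (\<Union>r\<in>{..m}. \<Union>s\<in>{..Suc m}. \<Union>v\<in>{..<2 ^ (m - r)}. \<Union>u\<in>{..<2 ^ (Suc m - s)}. T r s v u)"
    by (intro card_mono) (auto simp: T_def)
  also have "\<dots> \<le> (\<Sum>r\<in>{..m}. \<Sum>s\<in>{..Suc m}. \<Sum>v\<in>{..<2 ^ (m - r)}. \<Sum>u\<in>{..<2 ^ (Suc m - s)}. card (T r s v u))"
    by (intro order_trans[OF card_UN_le] sum_mono) auto
  finally have "real (card ?G) \<le> (\<Sum>r\<in>{..m}. \<Sum>s\<in>{..Suc m}. \<Sum>v\<in>{..<(2::nat) ^ (m - r)}. \<Sum>u\<in>{..<(2::nat) ^ (Suc m - s)}. real (card (T r s v u)))"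
    by (simp only: of_nat_sum[symmetric] of_nat_le_iff)
  also have "\<dots> \<le> (\<Sum>r\<in>{..m}. \<Sum>s\<in>{..Suc m}. \<Sum>v\<in>{..<(2::nat) ^ (m - r)}. \<Sum>u\<in>{..<(2::nat) ^ (Suc m - s)}.
      real b ^ K * (2 ^ r * (2 ^ s / b)) / \<mu>\<^sup>2)"
    by (intro sum_mono T) auto
  also have "\<dots> = (\<Sum>r\<in>{..m}. \<Sum>s\<in>{..Suc m}. real b ^ K / (real m + 2) ^ 4)"
  proof (intro sum.cong refl)
    fix r s assume rs: "r \<in> {..m}" "s \<in> {..Suc m}"
    have "(\<Sum>v\<in>{..<(2::nat) ^ (m - r)}. \<Sum>u\<in>{..<(2::nat) ^ (Suc m - s)}. real b ^ K * (2 ^ r * (2 ^ s / b)) / \<mu>\<^sup>2)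
        = (2 ^ (m - r) * 2 ^ r) * ((2 ^ (Suc m - s) * 2 ^ s) / b) * real b ^ K / \<mu>\<^sup>2"
      by simp
    also have "(2::real) ^ (m - r) * 2 ^ r = 2 ^ m" using rs by (simp flip: power_add)
    also have "(2::real) ^ (Suc m - s) * 2 ^ s = b" using rs by (simp add: b_def del: power_Suc flip: power_add)
    finally show "(\<Sum>v\<in>{..<(2::nat) ^ (m - r)}. \<Sum>u\<in>{..<(2::nat) ^ (Suc m - s)}. real b ^ K * (2 ^ r * (2 ^ s / b)) / \<mu>\<^sup>2)
        = real b ^ K / (real m + 2) ^ 4"
      using b by (simp add: \<mu>2)
  qed
  also have "\<dots> = (real m + 1) * (real m + 2) * (real b ^ K / (real m + 2) ^ 4)"
    by (simp add: algebra_simps)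
  also have "\<dots> \<le> (real m + 2) * (real m + 2) * (real b ^ K / (real m + 2) ^ 4)"
    by (intro mult_right_mono) auto
  also have "\<dots> = real b ^ K / (real m + 2)\<^sup>2"
    by (simp add: power4_eq_xxxx power2_eq_square)
  finally show ?thesis by (simp add: K_def)
qed

lemma summable_inverse_square_shift: "summable (\<lambda>m. 1 / (real m + 2)\<^sup>2)"
proof -
  have "summable (\<lambda>m. 1 / (real (m + 2))\<^sup>2)"
    using inverse_power_summable[of 2, where ?'a = real] by (subst summable_iff_shift) (simp add: field_simps)
  then show ?thesis by (simp add: add.commute)
qed

lemma floor_mult_less:
  assumes "0 < N" "0 \<le> \<alpha>" "\<alpha> < 1"
  shows "nat \<lfloor>real N * \<alpha>\<rfloor> < N"
proof -
  have "real N * \<alpha> < real N * 1"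
    using assms by (intro mult_strict_left_mono) auto
  then show ?thesis using assms by (simp add: nat_less_iff floor_less_iff)
qed

text \<open>The power (m + 2)^4 collects (m + 2)^2 from the union bound over rectangles and one
  factor from each of the two dyadic decompositions. All n and all intervals share one exceptional
  set.\<close>

lemma AE_abs_dev_chunk_le:
  "AE \<alpha> in lebesgue. \<alpha> \<in> {0..<1} \<longrightarrow> (\<forall>\<^sub>F m in sequentially. \<forall>n\<le>2 ^ m. \<forall>a c. 0 \<le> a \<longrightarrow> a \<le> c \<longrightarrow> c \<le> 1 \<longrightarrow>
     \<bar>dev \<alpha> (chunk (2 ^ Suc m) (J m) n) a c\<bar> \<le> 8 * (sqrt (2 ^ m) * (real m + 2) ^ 4))"
proof -
  define b M :: "nat \<Rightarrow> nat" where "b m = 2 ^ Suc m" and "M m = 2 ^ m" for m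
  define \<mu> where "\<mu> m = sqrt (2 ^ m) * (real m + 2)\<^sup>2" for m
  define G where "G m = {t \<in> {..<b m ^ (J m + M m)}. \<exists>r\<le>m. \<exists>s\<le>Suc m. \<exists>v<2 ^ (m - r). \<exists>u<2 ^ (Suc m - s).
      \<mu> m < \<bar>digit_dev (b m) (M m) t (v * 2 ^ r) ((v + 1) * 2 ^ r) (u * 2 ^ s) ((u + 1) * 2 ^ s)\<bar>}" for m
  have "AE \<alpha> in lebesgue. 0 \<le> \<alpha> \<longrightarrow> (\<forall>\<^sub>F m in sequentially. nat \<lfloor>real (b m ^ (J m + M m)) * \<alpha>\<rfloor> \<notin> G m)"
  proof (rule AE_eventually_floor_notin[OF _ _ _ summable_inverse_square_shift])
    show "real (card (G m)) \<le> real (b m ^ (J m + M m)) * (1 / (real m + 2)\<^sup>2)" for m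
      unfolding G_def \<mu>_def b_def M_def by (rule card_exceptional_digits)
  qed (auto simp: G_def b_def)
  then show ?thesis
  proof (eventually_elim, intro impI)
    fix \<alpha> :: real
    assume \<alpha>: "\<alpha> \<in> {0..<1}" and
      "0 \<le> \<alpha> \<longrightarrow> (\<forall>\<^sub>F m in sequentially. nat \<lfloor>real (b m ^ (J m + M m)) * \<alpha>\<rfloor> \<notin> G m)"
    then have "\<forall>\<^sub>F m in sequentially. nat \<lfloor>real (b m ^ (J m + M m)) * \<alpha>\<rfloor> \<notin> G m" by simp
    then show "\<forall>\<^sub>F m in sequentially. \<forall>n\<le>2 ^ m. \<forall>a c. 0 \<le> a \<longrightarrow> a \<le> c \<longrightarrow> c \<le> 1 \<longrightarrow>
      \<bar>dev \<alpha> (chunk (2 ^ Suc m) (J m) n) a c\<bar> \<le> 8 * (sqrt (2 ^ m) * (real m + 2) ^ 4)"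
    proof (eventually_elim, intro allI impI)
      fix m n :: nat and a c :: real
      assume notin: "nat \<lfloor>real (b m ^ (J m + M m)) * \<alpha>\<rfloor> \<notin> G m" and n: "n \<le> 2 ^ m"
        and ac: "0 \<le> a" "a \<le> c" "c \<le> 1"
      define t where "t = nat \<lfloor>real (b m ^ (J m + M m)) * \<alpha>\<rfloor>"
      have "t < b m ^ (J m + M m)"
        unfolding t_def using \<alpha> by (intro floor_mult_less) (auto simp: b_def)
      with notin have small: "\<bar>digit_dev (b m) (M m) t (v * 2 ^ r) ((v + 1) * 2 ^ r) (u * 2 ^ s) ((u + 1) * 2 ^ s)\<bar> \<le> \<mu> m"
        if "r \<le> m" "v < 2 ^ (m - r)" "s \<le> Suc m" "u < 2 ^ (Suc m - s)" for r s v u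
        using that unfolding G_def t_def[symmetric] mem_Collect_eq lessThan_iff by (meson not_less)
      define E where "E = (real m + 1) * ((real (Suc m) + 1) * \<mu> m)"
      have E: "\<bar>\<Sum>i<n. indicator {0..<k} (nat \<lfloor>real (b m) * frac (real (b m ^ (J m + i)) * \<alpha>)\<rfloor>) - real k / b m\<bar> \<le> E"
        if "k \<le> b m" for k
      proof -
        have "(\<Sum>i<n. indicator {0..<k} (nat \<lfloor>real (b m) * frac (real (b m ^ (J m + i)) * \<alpha>)\<rfloor>) - real k / b m)
            = digit_dev (b m) (M m) t 0 n 0 k"
          unfolding digit_dev_def t_def lessThan_atLeast0
          using n \<alpha> by (intro sum.cong refl) (subst digit_of_frac[where M = "M m"], auto simp: b_def M_def)
        also have "\<bar>\<dots>\<bar> \<le> E"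
          unfolding E_def using small n that by (intro abs_digit_dev_le) (auto simp: b_def)
        finally show ?thesis by simp
      qed
      have "\<bar>dev \<alpha> (chunk (b m) (J m) n) a c\<bar> \<le> 4 * E + 4"
        using n by (intro abs_dev_chunk_le E ac) (auto simp: b_def)
      also have "E \<le> (real m + 2) * ((real m + 2) * \<mu> m)"
        unfolding E_def by (intro mult_mono mult_right_mono) (auto simp: \<mu>_def)
      also have "\<dots> = sqrt (2 ^ m) * (real m + 2) ^ 4"
        by (simp add: \<mu>_def power4_eq_xxxx power2_eq_square mult_ac)
      also have "4 * (sqrt (2 ^ m) * (real m + 2) ^ 4) + 4 \<le> 8 * (sqrt (2 ^ m) * (real m + 2) ^ 4)"
      proof -
        have "1 * 1 \<le> sqrt (2 ^ m) * (real m + 2) ^ 4"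
          by (intro mult_mono) (auto intro!: one_le_power)
        then show ?thesis by simp
      qed
      finally show "\<bar>dev \<alpha> (chunk (2 ^ Suc m) (J m) n) a c\<bar> \<le> 8 * (sqrt (2 ^ m) * (real m + 2) ^ 4)"
        by (simp add: b_def)
    qed
  qed
qed

section \<open>Lower bound for blocks of powers\<close>

lemma binomial_two_power_le: "real ((2 ^ m) choose r) * sqrt (2 ^ m) \<le> 2 ^ 2 ^ m"
proof (cases m)
  \<comment> \<open>Here the upper index is 1, which is odd, so the central binomial estimate does
    not apply.\<close>
  case 0
  have "(1::nat) choose r \<le> 1" using binomial_maximum[of 1 r] by simp
  then show ?thesis using 0 by simp
next
  case (Suc k)
  define n :: nat where "n = 2 ^ k"
  have M: "2 ^ m = 2 * n" by (simp add: Suc n_def)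
  then have rM: "(2::real) ^ m = 2 * real n" by (metis of_nat_mult of_nat_numeral of_nat_power)
  have "real ((2 * n) choose r) * sqrt (2 * real n) \<le> real ((2 * n) choose n) * sqrt (real (2 * n + 1))"
    by (intro mult_mono) (auto simp: binomial_maximum')
  also have "\<dots> \<le> 4 ^ n" by (rule central_binomial_upper)
  finally show ?thesis by (simp add: M rM power_mult)
qed

text \<open>At most 2 \<eta> + 1 counts lie within \<eta> of the mean M/2, and each is attained with
  probability at most 2^(-m/2). Dividing the standard scale by (m + 2)^2 in \<eta> makes the total
  summable.\<close>

lemma card_balanced_digits:
  fixes m J :: nat
  defines "b \<equiv> 2 ^ Suc m" and "M \<equiv> 2 ^ m"
  defines "\<eta> \<equiv> sqrt (2 ^ m) / (real m + 2)\<^sup>2"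
  shows "real (card {t \<in> {..<b ^ (J + M)}. \<bar>real (card {i \<in> {..<M}. t div b ^ i mod b < 2 ^ m}) - real M / 2\<bar> < \<eta>})
    \<le> real (b ^ (J + M)) * (2 / (real m + 2)\<^sup>2 + 1 / sqrt (2 ^ m))" (is "real (card ?G) \<le> _")
proof -
  define K where "K = J + M"
  define R where "R = {r::nat. \<bar>real r - real M / 2\<bar> < \<eta>}"
  define Z where "Z = {z::int. real M / 2 - \<eta> \<le> z \<and> z < real M / 2 + \<eta>}"
  define T where "T r = {t \<in> {..<b ^ K}. card {i \<in> {..<M}. t div b ^ i mod b < 2 ^ m} = r}" for r
  have b: "b = 2 * 2 ^ m" by (simp add: b_def)
  have \<eta>: "0 \<le> \<eta>" by (simp add: \<eta>_def)
  have Z: "finite Z" "real (card Z) \<le> 2 * \<eta> + 1"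
    using card_ints_in_interval[of "real M / 2 - \<eta>" "real M / 2 + \<eta>"] \<eta> by (auto simp: Z_def)
  have sub: "int ` R \<subseteq> Z" by (auto simp: R_def Z_def abs_less_iff)
  have "finite (int ` R)" using sub Z(1) by (rule finite_subset)
  then have finR: "finite R" by (rule finite_imageD) simp
  have "card R = card (int ` R)" by (simp add: card_image)
  also have "\<dots> \<le> card Z" using sub Z(1) by (intro card_mono)
  finally have cR: "real (card R) \<le> 2 * \<eta> + 1" using Z by linarith
  have T: "real (card (T r)) \<le> real b ^ K * (1 / sqrt (2 ^ m))" for r
  proof -
    have "{..<M} \<subseteq> {..<K}" by (auto simp: K_def)
    then have "real (card (T r)) = real b ^ K * (real (M choose r) / 2 ^ M)"
      unfolding T_def b by (subst card_digit_count_eq) auto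
    also have "real (M choose r) / 2 ^ M \<le> 1 / sqrt (2 ^ m)"
      using binomial_two_power_le[of m r] by (simp add: field_simps M_def)
    finally show ?thesis by (simp add: mult_left_mono)
  qed
  have "?G \<subseteq> (\<Union>r\<in>R. T r)" by (auto simp: T_def R_def K_def)
  then have "card ?G \<le> card (\<Union>r\<in>R. T r)" using finR by (intro card_mono) (auto simp: T_def)
  also have "\<dots> \<le> (\<Sum>r\<in>R. card (T r))" by (rule card_UN_le[OF finR])
  finally have "real (card ?G) \<le> (\<Sum>r\<in>R. real (card (T r)))"
    by (simp only: of_nat_sum[symmetric] of_nat_le_iff)
  also have "\<dots> \<le> (\<Sum>r\<in>R. real b ^ K * (1 / sqrt (2 ^ m)))" by (intro sum_mono T)
  also have "\<dots> = real (card R) * (real b ^ K * (1 / sqrt (2 ^ m)))" by simp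
  also have "\<dots> \<le> (2 * \<eta> + 1) * (real b ^ K * (1 / sqrt (2 ^ m)))"
    using cR by (intro mult_right_mono) auto
  also have "\<dots> = real b ^ K * (2 / (real m + 2)\<^sup>2 + 1 / sqrt (2 ^ m))"
  proof -
    have "\<eta> / sqrt (2 ^ m) = 1 / (real m + 2)\<^sup>2" by (simp add: \<eta>_def)
    then have "(2 * \<eta> + 1) * (1 / sqrt (2 ^ m)) = 2 / (real m + 2)\<^sup>2 + 1 / sqrt (2 ^ m)"
      by (simp add: add_divide_distrib)
    then show ?thesis by (metis mult.left_commute)
  qed
  finally show ?thesis by (simp add: K_def)
qed

text \<open>In the even base 2h membership in [0, 1/2) is decided by the leading digit alone, so no
  rounding error arises; this is why the lower bound tests that interval.\<close>

lemma dev_chunk_half: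
  assumes h: "0 < h" and \<alpha>: "0 \<le> \<alpha>"
  shows "dev \<alpha> (chunk (2 * h) J M) 0 (1 / 2)
    = real (card {i \<in> {..<M}. nat \<lfloor>real ((2 * h) ^ (J + M)) * \<alpha>\<rfloor> div (2 * h) ^ i mod (2 * h) < h}) - real M / 2"
proof -
  define b where "b = 2 * h"
  define t where "t = nat \<lfloor>real (b ^ (J + M)) * \<alpha>\<rfloor>"
  have b: "2 \<le> b" using h by (simp add: b_def)
  have iff: "frac (real (b ^ (J + i)) * \<alpha>) \<in> {0..<1 / 2} \<longleftrightarrow> t div b ^ (M - 1 - i) mod b < h" if "i < M" for i
  proof -
    define f where "f = frac (real (b ^ (J + i)) * \<alpha>)"
    have f: "0 \<le> f" by (simp add: f_def)
    have "f < 1 / 2 \<longleftrightarrow> real b * f < real h" using h by (simp add: b_def field_simps)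
    also have "\<dots> \<longleftrightarrow> nat \<lfloor>real b * f\<rfloor> < h" using f by (simp add: nat_less_iff floor_less_iff)
    also have "nat \<lfloor>real b * f\<rfloor> = t div b ^ (M - 1 - i) mod b"
      unfolding f_def t_def by (rule digit_of_frac) (use b \<alpha> that in auto)
    finally show ?thesis using f by (simp add: f_def)
  qed
  have "{n \<in> chunk b J M. frac (real n * \<alpha>) \<in> {0..<1 / 2}}
      = (\<lambda>i. b ^ (J + i)) ` {i \<in> {..<M}. t div b ^ (M - 1 - i) mod b < h}"
    unfolding chunk_def using iff by blast
  then have "card {n \<in> chunk b J M. frac (real n * \<alpha>) \<in> {0..<1 / 2}}
      = card {i \<in> {..<M}. t div b ^ (M - 1 - i) mod b < h}"
    using b by (simp only: card_image[OF inj_chunk])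
  also have "\<dots> = card {i \<in> {..<M}. t div b ^ i mod b < h}"
    by (rule bij_betw_same_card[of "\<lambda>i. M - 1 - i"], rule bij_betw_byWitness[where f' = "\<lambda>i. M - 1 - i"]) auto
  finally show ?thesis
    unfolding b_def[symmetric] t_def[symmetric] using b by (simp only: dev_eq_card[OF finite_chunk] card_chunk) simp
qed

lemma AE_abs_dev_chunk_ge:
  "AE \<alpha> in lebesgue. \<alpha> \<in> {0..<1} \<longrightarrow> (\<forall>\<^sub>F m in sequentially.
     sqrt (2 ^ m) / (real m + 2)\<^sup>2 \<le> \<bar>dev \<alpha> (chunk (2 ^ Suc m) (J m) (2 ^ m)) 0 (1 / 2)\<bar>)"
proof -
  define b M :: "nat \<Rightarrow> nat" where "b m = 2 ^ Suc m" and "M m = 2 ^ m" for m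
  define G where "G m = {t \<in> {..<b m ^ (J m + M m)}.
      \<bar>real (card {i \<in> {..<M m}. t div b m ^ i mod b m < 2 ^ m}) - real (M m) / 2\<bar> < sqrt (2 ^ m) / (real m + 2)\<^sup>2}" for m
  have summ: "summable (\<lambda>m. 2 / (real m + 2)\<^sup>2 + 1 / sqrt (2 ^ m))"
  proof (rule summable_add)
    show "summable (\<lambda>m. 2 / (real m + 2)\<^sup>2)"
      using summable_mult[OF summable_inverse_square_shift, of 2] by simp
    have "summable (\<lambda>m. (1 / sqrt 2) ^ m)" by (intro summable_geometric) simp
    then show "summable (\<lambda>m. 1 / sqrt (2 ^ m))" by (simp add: power_divide real_sqrt_power)
  qed
  have "AE \<alpha> in lebesgue. 0 \<le> \<alpha> \<longrightarrow> (\<forall>\<^sub>F m in sequentially. nat \<lfloor>real (b m ^ (J m + M m)) * \<alpha>\<rfloor> \<notin> G m)"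
  proof (rule AE_eventually_floor_notin[OF _ _ _ summ])
    show "real (card (G m)) \<le> real (b m ^ (J m + M m)) * (2 / (real m + 2)\<^sup>2 + 1 / sqrt (2 ^ m))" for m
      unfolding G_def b_def M_def by (rule card_balanced_digits)
  qed (auto simp: G_def b_def)
  then show ?thesis
  proof (eventually_elim, intro impI)
    fix \<alpha> :: real
    assume \<alpha>: "\<alpha> \<in> {0..<1}" and
      "0 \<le> \<alpha> \<longrightarrow> (\<forall>\<^sub>F m in sequentially. nat \<lfloor>real (b m ^ (J m + M m)) * \<alpha>\<rfloor> \<notin> G m)"
    then have "\<forall>\<^sub>F m in sequentially. nat \<lfloor>real (b m ^ (J m + M m)) * \<alpha>\<rfloor> \<notin> G m" by simp
    then show "\<forall>\<^sub>F m in sequentially.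
      sqrt (2 ^ m) / (real m + 2)\<^sup>2 \<le> \<bar>dev \<alpha> (chunk (2 ^ Suc m) (J m) (2 ^ m)) 0 (1 / 2)\<bar>"
    proof eventually_elim
      case (elim m)
      define t where "t = nat \<lfloor>real (b m ^ (J m + M m)) * \<alpha>\<rfloor>"
      have "t < b m ^ (J m + M m)"
        unfolding t_def using \<alpha> by (intro floor_mult_less) (auto simp: b_def)
      then have "sqrt (2 ^ m) / (real m + 2)\<^sup>2
          \<le> \<bar>real (card {i \<in> {..<M m}. t div b m ^ i mod b m < 2 ^ m}) - real (M m) / 2\<bar>"
        using elim unfolding G_def t_def[symmetric] by auto
      also have "real (card {i \<in> {..<M m}. t div b m ^ i mod b m < 2 ^ m}) - real (M m) / 2
          = dev \<alpha> (chunk (b m) (J m) (M m)) 0 (1 / 2)"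
        using dev_chunk_half[of "2 ^ m" \<alpha> "J m" "M m"] \<alpha> by (simp add: b_def t_def)
      finally show ?case by (simp add: b_def M_def)
    qed
  qed
qed

section \<open>The sequence\<close>

text \<open>
  Stage \<open>m\<close> consists of \<open>len \<gamma> m\<close> consecutive integers from \<open>start \<gamma> m\<close> on and of the powers of \<open>2\<^sup>m\<^sup>+\<^sup>1\<close> with
  the \<open>2\<^sup>m\<close> exponents from \<open>stop \<gamma> m\<close> on. Using the value \<open>stop \<gamma> m\<close> itself as an exponent keeps the
  powers above the run.
\<close>

definition weight :: "nat \<Rightarrow> real" where
  "weight m = sqrt (2 ^ m) * (real m + 2) ^ 4"

definition len :: "real \<Rightarrow> nat \<Rightarrow> nat" where
  "len \<gamma> m = nat \<lceil>weight m powr (1 / \<gamma>)\<rceil>"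

text \<open>The next stage starts at the power that would follow the last one of stage m, its
  exponent being \<open>stop \<gamma> m + 2 ^ m\<close>. The initial value 1 keeps all elements
  positive.\<close>

primrec start :: "real \<Rightarrow> nat \<Rightarrow> nat" where
  "start \<gamma> 0 = 1"
| "start \<gamma> (Suc m) = (2 ^ Suc m) ^ (start \<gamma> m + len \<gamma> m + 2 ^ m)"

declare start.simps [simp del]

definition stop :: "real \<Rightarrow> nat \<Rightarrow> nat" where
  "stop \<gamma> m = start \<gamma> m + len \<gamma> m"

definition stage :: "real \<Rightarrow> nat \<Rightarrow> nat set" where
  "stage \<gamma> m = {start \<gamma> m..<stop \<gamma> m} \<union> chunk (2 ^ Suc m) (stop \<gamma> m) (2 ^ m)"

definition value_set :: "real \<Rightarrow> nat set" where
  "value_set \<gamma> = (\<Union>m. stage \<gamma> m)"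

section \<open>Growth of the weights and of the run lengths\<close>

lemma weight_ge_1: "1 \<le> weight m"
proof -
  have "1 * 1 \<le> sqrt (2 ^ m) * (real m + 2) ^ 4"
    by (intro mult_mono) (auto intro!: one_le_power)
  then show ?thesis by (simp add: weight_def)
qed

lemma weight_mono: "i \<le> m \<Longrightarrow> weight i \<le> weight m"
  unfolding weight_def by (intro mult_mono power_mono) (auto simp: power_increasing)

lemma sum_weight_le: "(\<Sum>i<Suc m. weight i) \<le> 4 * weight m"
proof (induction m)
  case 0
  then show ?case using weight_ge_1[of 0] by simp
next
  case (Suc m)
  have "4 / 3 \<le> sqrt 2" by (rule real_le_rsqrt) (simp add: power2_eq_square)
  have "4 / 3 * weight m \<le> sqrt 2 * weight m"
    using \<open>4 / 3 \<le> sqrt 2\<close> weight_ge_1[of m] by (intro mult_right_mono) auto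
  also have "\<dots> = sqrt (2 ^ Suc m) * (real m + 2) ^ 4" by (simp add: weight_def real_sqrt_mult)
  also have "\<dots> \<le> weight (Suc m)"
    unfolding weight_def by (intro mult_left_mono power_mono) auto
  finally have "4 / 3 * weight m \<le> weight (Suc m)" .
  with Suc show ?case by simp
qed

lemma weight_le_len: "weight m powr (1 / \<gamma>) \<le> real (len \<gamma> m)"
  unfolding len_def by (simp add: real_nat_ceiling_ge)

lemma len_le: "real (len \<gamma> m) \<le> 2 * weight m powr (1 / \<gamma>)" if "0 < \<gamma>"
proof -
  have "1 \<le> weight m powr (1 / \<gamma>)" using that by (intro ge_one_powr_ge_zero weight_ge_1) auto
  then show ?thesis unfolding len_def by linarith
qed

lemma len_mono: "0 < \<gamma> \<Longrightarrow> i \<le> m \<Longrightarrow> len \<gamma> i \<le> len \<gamma> m"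
  unfolding len_def using weight_ge_1[of i]
  by (intro nat_mono ceiling_mono powr_mono2 weight_mono) auto

lemma weight_le_len_powr: "0 < \<gamma> \<Longrightarrow> weight m \<le> real (len \<gamma> m) powr \<gamma>"
proof -
  assume \<gamma>: "0 < \<gamma>"
  have "weight m = (weight m powr (1 / \<gamma>)) powr \<gamma>"
    using weight_ge_1[of m] \<gamma> by (simp add: powr_powr)
  also have "\<dots> \<le> real (len \<gamma> m) powr \<gamma>"
    using weight_le_len \<gamma> by (intro powr_mono2) auto
  finally show ?thesis .
qed

lemma len_powr_le: "0 < \<gamma> \<Longrightarrow> \<gamma> \<le> 1 \<Longrightarrow> real (len \<gamma> m) powr \<gamma> \<le> 2 * weight m"
proof -
  assume \<gamma>: "0 < \<gamma>" "\<gamma> \<le> 1"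
  have "real (len \<gamma> m) powr \<gamma> \<le> (2 * weight m powr (1 / \<gamma>)) powr \<gamma>"
    using len_le \<gamma> by (intro powr_mono2) auto
  also have "\<dots> = 2 powr \<gamma> * weight m"
    using weight_ge_1[of m] \<gamma> by (simp add: powr_mult powr_powr)
  also have "\<dots> \<le> 2 powr 1 * weight m"
    using weight_ge_1[of m] \<gamma> by (intro mult_right_mono powr_mono) auto
  finally show ?thesis by simp
qed

text \<open>Here \<gamma> \<le> 1/2 enters: 1/\<gamma> \<ge> 2, and the square of the weight is at
  least 2^m. In the lower bound this keeps N comparable, up to a factor of order m, to the length of
  the last run.\<close>

lemma two_power_le_len: "0 < \<gamma> \<Longrightarrow> \<gamma> \<le> 1 / 2 \<Longrightarrow> 2 ^ m \<le> len \<gamma> m"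
proof -
  assume \<gamma>: "0 < \<gamma>" "\<gamma> \<le> 1 / 2"
  have "sqrt (2 ^ m) * 1 \<le> weight m"
    unfolding weight_def by (intro mult_left_mono) (auto intro!: one_le_power)
  then have "(sqrt (2 ^ m))\<^sup>2 \<le> (weight m)\<^sup>2" by (intro power_mono) auto
  also have "\<dots> = weight m powr 2" using weight_ge_1[of m] by (simp add: powr_numeral)
  also have "\<dots> \<le> weight m powr (1 / \<gamma>)"
    using \<gamma> weight_ge_1 by (intro powr_mono) (auto simp: field_simps)
  also have "\<dots> \<le> real (len \<gamma> m)" by (rule weight_le_len)
  finally have "real (2 ^ m) \<le> real (len \<gamma> m)" by simp
  then show ?thesis by (simp only: of_nat_le_iff)
qed

section \<open>Separation of the stages\<close>

lemma chunk_subset: "chunk (2 ^ Suc m) (stop \<gamma> m) n \<subseteq> {stop \<gamma> m<..}"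
proof -
  have "k < (2 ^ Suc m) ^ (k + i)" for k i :: nat
  proof -
    have "k < 2 ^ k" by (rule less_exp)
    also have "(2::nat) ^ k \<le> (2 ^ Suc m) ^ k" by (intro power_mono) (auto simp: self_le_power)
    also have "(2 ^ Suc m) ^ k \<le> ((2::nat) ^ Suc m) ^ (k + i)" by (intro power_increasing) auto
    finally show ?thesis .
  qed
  then show ?thesis by (auto simp: chunk_def)
qed

lemma stop_less_start_Suc: "stop \<gamma> m < start \<gamma> (Suc m)"
proof -
  \<comment> \<open>The next start is the last element of the block prolonged by one power, so
    \<open>chunk_subset\<close> covers it as well.\<close>
  have "(2 ^ Suc m) ^ (stop \<gamma> m + 2 ^ m) \<in> chunk (2 ^ Suc m) (stop \<gamma> m) (Suc (2 ^ m))"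
    by (auto simp: chunk_def)
  then show ?thesis using chunk_subset by (fastforce simp: stop_def start.simps)
qed

lemma start_le_stop: "start \<gamma> m \<le> stop \<gamma> m"
  by (simp add: stop_def)

lemma stage_subset: "stage \<gamma> m \<subseteq> {start \<gamma> m..<start \<gamma> (Suc m)}"
proof -
  have "chunk (2 ^ Suc m) (stop \<gamma> m) (2 ^ m) \<subseteq> {..<start \<gamma> (Suc m)}"
  proof
    fix k assume "k \<in> chunk (2 ^ Suc m) (stop \<gamma> m) (2 ^ m)"
    then obtain i where i: "i < 2 ^ m" "k = (2 ^ Suc m) ^ (stop \<gamma> m + i)" by (auto simp: chunk_def)
    have "((2::nat) ^ Suc m) ^ (stop \<gamma> m + i) < (2 ^ Suc m) ^ (stop \<gamma> m + 2 ^ m)"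
      using i by (intro power_strict_increasing) auto
    then show "k \<in> {..<start \<gamma> (Suc m)}" using i by (simp add: stop_def start.simps)
  qed
  then show ?thesis
    using chunk_subset[of m \<gamma> "2 ^ m"] stop_less_start_Suc[of \<gamma> m] start_le_stop[of \<gamma> m]
    by (auto simp: stage_def dest!: subsetD)
qed

lemma strict_mono_start: "strict_mono (start \<gamma>)"
  by (rule strict_mono_Suc_iff[THEN iffD2])
    (meson start_le_stop stop_less_start_Suc order.strict_trans1)

lemma value_set_below_start_0: "value_set \<gamma> \<inter> {..<start \<gamma> 0} = {}"
proof -
  have "start \<gamma> 0 \<le> start \<gamma> m" for m
    by (rule monoD[OF strict_mono_mono[OF strict_mono_start]]) simp
  moreover have "start \<gamma> m \<le> k" if "k \<in> stage \<gamma> m" for m k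
    using subsetD[OF stage_subset that] by simp
  ultimately have "start \<gamma> 0 \<le> k" if "k \<in> value_set \<gamma>" for k
    using that unfolding value_set_def by (meson UN_E order_trans)
  then show ?thesis by (auto simp: not_less[symmetric])
qed

lemma value_set_Int_stage: "value_set \<gamma> \<inter> {start \<gamma> m..<start \<gamma> (Suc m)} = stage \<gamma> m"
proof -
  have "i = m" if "k \<in> stage \<gamma> i" "start \<gamma> m \<le> k" "k < start \<gamma> (Suc m)" for i k
  proof -
    have "start \<gamma> i \<le> k" "k < start \<gamma> (Suc i)" using stage_subset that by fastforce+
    then have "start \<gamma> i < start \<gamma> (Suc m)" "start \<gamma> m < start \<gamma> (Suc i)" using that by linarith+
    then have "i < Suc m" "m < Suc i" using strict_mono_less[OF strict_mono_start] by blast+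
    then show ?thesis by simp
  qed
  then show ?thesis
    using stage_subset[of \<gamma> m] unfolding value_set_def by (blast dest: atLeastLessThan_iff[THEN iffD1])
qed

lemma finite_stage [simp]: "finite (stage \<gamma> m)"
  by (simp add: stage_def)

lemma value_set_split:
  assumes "start \<gamma> m \<le> x" "x \<le> start \<gamma> (Suc m)"
  shows "value_set \<gamma> \<inter> {..<x} = (value_set \<gamma> \<inter> {..<start \<gamma> m}) \<union> (stage \<gamma> m \<inter> {..<x})"
  using assms unfolding value_set_Int_stage[symmetric] by auto

lemma dev_stage:
  "dev \<alpha> (stage \<gamma> m) a b = dev \<alpha> {start \<gamma> m..<start \<gamma> m + len \<gamma> m} a b
    + dev \<alpha> (chunk (2 ^ Suc m) (stop \<gamma> m) (2 ^ m)) a b"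
  unfolding stage_def stop_def[symmetric]
  using chunk_subset[of m \<gamma> "2 ^ m"] by (intro dev_Un_disjoint) fastforce+

lemma value_set_Suc:
  "value_set \<gamma> \<inter> {..<start \<gamma> (Suc m)} = (value_set \<gamma> \<inter> {..<start \<gamma> m}) \<union> stage \<gamma> m"
proof -
  have "stage \<gamma> m \<inter> {..<start \<gamma> (Suc m)} = stage \<gamma> m"
    using stage_subset[of \<gamma> m] by fastforce
  then show ?thesis
    using value_set_split[of \<gamma> m "start \<gamma> (Suc m)"] strict_mono_less_eq[OF strict_mono_start, of \<gamma> m "Suc m"]
    by simp
qed

lemma dev_value_set_start:
  "dev \<alpha> (value_set \<gamma> \<inter> {..<start \<gamma> m}) a b = (\<Sum>i<m. dev \<alpha> (stage \<gamma> i) a b)"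
proof (induction m)
  case 0
  then show ?case using value_set_below_start_0 by simp
next
  case (Suc m)
  have "dev \<alpha> (value_set \<gamma> \<inter> {..<start \<gamma> (Suc m)}) a b
      = dev \<alpha> (value_set \<gamma> \<inter> {..<start \<gamma> m}) a b + dev \<alpha> (stage \<gamma> m) a b"
    unfolding value_set_Suc using stage_subset[of \<gamma> m] by (intro dev_Un_disjoint) fastforce+
  then show ?case using Suc by simp
qed

lemma card_value_set_start:
  "card (value_set \<gamma> \<inter> {..<start \<gamma> m}) = (\<Sum>i<m. len \<gamma> i + 2 ^ i)"
proof (induction m)
  case 0
  then show ?case using value_set_below_start_0 by simp
next
  case (Suc m)
  have "card (value_set \<gamma> \<inter> {..<start \<gamma> (Suc m)}) = card (value_set \<gamma> \<inter> {..<start \<gamma> m}) + card (stage \<gamma> m)"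
    unfolding value_set_Suc using stage_subset[of \<gamma> m] by (intro card_Un_disjoint) fastforce+
  moreover have "card (stage \<gamma> m) = card {start \<gamma> m..<stop \<gamma> m} + card (chunk (2 ^ Suc m) (stop \<gamma> m) (2 ^ m))"
    unfolding stage_def using chunk_subset[of m \<gamma> "2 ^ m"] by (intro card_Un_disjoint) fastforce+
  moreover have "card (chunk (2 ^ Suc m) (stop \<gamma> m) (2 ^ m)) = 2 ^ m"
    by (intro card_chunk) simp
  ultimately show ?case using Suc by (simp add: stop_def)
qed

section \<open>Initial segments of the value set\<close>

lemma initial_segment_below:
  fixes f :: "nat \<Rightarrow> nat"
  assumes "mono f"
  shows "\<exists>n\<le>M. {i. i < M \<and> f i < x} = {..<n}"
proof (induction M)
  case (Suc M)
  show ?case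
  proof (cases "f M < x")
    case True
    then have "{i. i < Suc M \<and> f i < x} = {..<Suc M}"
      unfolding less_Suc_eq_le lessThan_Suc_atMost using le_less_trans[OF monoD[OF assms]] by blast
    then show ?thesis by blast
  next
    case False
    then have "{i. i < Suc M \<and> f i < x} = {i. i < M \<and> f i < x}"
      by (auto simp: less_Suc_eq)
    then show ?thesis using Suc le_SucI by metis
  qed
qed simp

text \<open>The alternative \<open>n = 0 \<or> l = len \<gamma> m\<close> carries the content: once
  a power is counted, the whole run is counted too, and N is large enough to absorb the deviation of
  the powers.\<close>

lemma stage_prefix:
  obtains l n where "l \<le> len \<gamma> m" "n \<le> 2 ^ m" "n = 0 \<or> l = len \<gamma> m"
    "stage \<gamma> m \<inter> {..<x} = {start \<gamma> m..<start \<gamma> m + l} \<union> chunk (2 ^ Suc m) (stop \<gamma> m) n"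
proof (cases "x \<le> stop \<gamma> m")
  case True
  then have "chunk (2 ^ Suc m) (stop \<gamma> m) (2 ^ m) \<inter> {..<x} = {}"
    using chunk_subset[of m \<gamma> "2 ^ m"] by fastforce
  \<comment> \<open>Truncated subtraction gives the empty run when x lies below the start.\<close>
  then have "stage \<gamma> m \<inter> {..<x} = {start \<gamma> m..<start \<gamma> m + (x - start \<gamma> m)} \<union> chunk (2 ^ Suc m) (stop \<gamma> m) 0"
    using True by (auto simp: stage_def chunk_def)
  then show ?thesis using True by (intro that[of "x - start \<gamma> m" 0]) (auto simp: stop_def)
next
  case False
  then have block: "{start \<gamma> m..<stop \<gamma> m} \<inter> {..<x} = {start \<gamma> m..<start \<gamma> m + len \<gamma> m}"
    by (auto simp: stop_def)
  define f :: "nat \<Rightarrow> nat" where "f i = (2 ^ Suc m) ^ (stop \<gamma> m + i)" for i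
  have "mono f" unfolding f_def by (intro monoI power_increasing) auto
  then obtain n where n: "n \<le> 2 ^ m" "{i. i < 2 ^ m \<and> f i < x} = {..<n}"
    using initial_segment_below by metis
  have "chunk (2 ^ Suc m) (stop \<gamma> m) (2 ^ m) \<inter> {..<x} = f ` {i. i < 2 ^ m \<and> f i < x}"
    by (auto simp: chunk_def f_def)
  then have "chunk (2 ^ Suc m) (stop \<gamma> m) (2 ^ m) \<inter> {..<x} = chunk (2 ^ Suc m) (stop \<gamma> m) n"
    unfolding n by (simp add: chunk_def f_def)
  then have "stage \<gamma> m \<inter> {..<x} = {start \<gamma> m..<start \<gamma> m + len \<gamma> m} \<union> chunk (2 ^ Suc m) (stop \<gamma> m) n"
    using block by (simp only: stage_def Int_Un_distrib2)
  then show ?thesis using n by (intro that[of "len \<gamma> m" n]) auto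
qed

text \<open>The current stage contributes C + D. An earlier stage i contributes at most (2C + D)
  weight i, and these weights sum to at most 4 times the last one, which is below
  \<open>N powr \<gamma>\<close> because that stage's run is fully counted. This adds 8C +
  4D.\<close>

lemma abs_dev_value_set_le:
  assumes \<gamma>: "0 < \<gamma>" "\<gamma> \<le> 1 / 2" and ab: "0 \<le> a" "a \<le> b" "b \<le> 1" and C: "0 \<le> C" "0 \<le> D"
    and blk: "\<And>B N. \<bar>dev \<alpha> {B..<B + N} a b\<bar> \<le> C * real N powr \<gamma>"
    and chk: "\<And>m n. n \<le> 2 ^ m \<Longrightarrow> \<bar>dev \<alpha> (chunk (2 ^ Suc m) (stop \<gamma> m) n) a b\<bar> \<le> D * weight m"
  shows "\<bar>dev \<alpha> (value_set \<gamma> \<inter> {..<x}) a b\<bar>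
    \<le> (9 * C + 5 * D) * real (card (value_set \<gamma> \<inter> {..<x})) powr \<gamma>"
proof (cases "x \<le> start \<gamma> 0")
  case True
  then have "value_set \<gamma> \<inter> {..<x} = {}" using value_set_below_start_0[of \<gamma>] by fastforce
  then show ?thesis by simp
next
  case False
  define m where "m = (LEAST m. x \<le> start \<gamma> (Suc m))"
  have "x \<le> start \<gamma> (Suc x)"
    using strict_mono_imp_increasing[OF strict_mono_start, of "Suc x" \<gamma>] by simp
  then have up: "x \<le> start \<gamma> (Suc m)" unfolding m_def by (rule LeastI)
  have low: "start \<gamma> m \<le> x"
  proof (cases m)
    case 0
    then show ?thesis using False by simp
  next
    case (Suc k)
    then have "\<not> x \<le> start \<gamma> (Suc k)" unfolding m_def by (intro not_less_Least) simp
    then show ?thesis using Suc by simp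
  qed
  obtain l n where ln: "l \<le> len \<gamma> m" "n \<le> 2 ^ m" "n = 0 \<or> l = len \<gamma> m"
    and st: "stage \<gamma> m \<inter> {..<x} = {start \<gamma> m..<start \<gamma> m + l} \<union> chunk (2 ^ Suc m) (stop \<gamma> m) n"
    by (rule stage_prefix)
  define F where "F = value_set \<gamma> \<inter> {..<x}"
  define P where "P = value_set \<gamma> \<inter> {..<start \<gamma> m}"
  define N where "N = real (card F) powr \<gamma>"
  have F: "F = P \<union> (stage \<gamma> m \<inter> {..<x})" unfolding F_def P_def by (rule value_set_split[OF low up])
  have fin: "finite F" "finite P" by (auto simp: F_def P_def)
  have "l \<le> card F"
    using card_mono[OF fin(1), of "{start \<gamma> m..<start \<gamma> m + l}"] by (auto simp: F st)
  then have lN: "real l powr \<gamma> \<le> N" unfolding N_def using \<gamma> by (intro powr_mono2) auto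
  have PN: "real (card P) powr \<gamma> \<le> N"
    unfolding N_def using \<gamma> card_mono[OF fin(1), of P] by (intro powr_mono2) (auto simp: F)
  have "dev \<alpha> F a b = dev \<alpha> P a b + dev \<alpha> (stage \<gamma> m \<inter> {..<x}) a b"
    unfolding F P_def using stage_subset[of \<gamma> m] by (intro dev_Un_disjoint) fastforce+
  also have "dev \<alpha> (stage \<gamma> m \<inter> {..<x}) a b
      = dev \<alpha> {start \<gamma> m..<start \<gamma> m + l} a b + dev \<alpha> (chunk (2 ^ Suc m) (stop \<gamma> m) n) a b"
    unfolding st using chunk_subset[of m \<gamma> n] ln by (intro dev_Un_disjoint) (fastforce simp: stop_def)+
  finally have dF: "dev \<alpha> F a b = dev \<alpha> P a b + (dev \<alpha> {start \<gamma> m..<start \<gamma> m + l} a b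
      + dev \<alpha> (chunk (2 ^ Suc m) (stop \<gamma> m) n) a b)" .
  have d1: "\<bar>dev \<alpha> {start \<gamma> m..<start \<gamma> m + l} a b\<bar> \<le> C * N"
    using blk lN C by (meson mult_left_mono order_trans)
  have d2: "\<bar>dev \<alpha> (chunk (2 ^ Suc m) (stop \<gamma> m) n) a b\<bar> \<le> D * N"
  proof (cases "n = 0")
    case True
    then show ?thesis using C by (simp add: chunk_def N_def)
  next
    case False
    then have "weight m \<le> N" using ln lN weight_le_len_powr[OF \<gamma>(1), of m] by simp
    then show ?thesis using chk[OF ln(2)] C by (meson mult_left_mono order_trans)
  qed
  have d3: "\<bar>dev \<alpha> P a b\<bar> \<le> (8 * C + 4 * D) * N"
  proof (cases m)
    case 0
    then have "P = {}" using value_set_below_start_0 by (simp add: P_def)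
    then show ?thesis using C by (simp add: N_def)
  next
    case (Suc k)
    have "\<bar>dev \<alpha> P a b\<bar> \<le> (\<Sum>i<m. \<bar>dev \<alpha> (stage \<gamma> i) a b\<bar>)"
      unfolding P_def dev_value_set_start by (rule sum_abs)
    also have "\<dots> \<le> (\<Sum>i<m. (2 * C + D) * weight i)"
    proof (intro sum_mono)
      fix i
      have "C * real (len \<gamma> i) powr \<gamma> \<le> C * (2 * weight i)"
        using \<gamma> C len_powr_le[of \<gamma> i] by (intro mult_left_mono) auto
      then show "\<bar>dev \<alpha> (stage \<gamma> i) a b\<bar> \<le> (2 * C + D) * weight i"
        using blk[of "start \<gamma> i" "len \<gamma> i"] chk[of "2 ^ i" i] unfolding dev_stage distrib_right
        by linarith
    qed
    also have "\<dots> = (2 * C + D) * (\<Sum>i<Suc k. weight i)" by (simp only: sum_distrib_left Suc)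
    also have "\<dots> \<le> (2 * C + D) * (4 * weight k)"
      using C sum_weight_le by (intro mult_left_mono) auto
    also have "\<dots> \<le> (2 * C + D) * (4 * N)"
    proof -
      have "len \<gamma> k \<le> card P"
        unfolding P_def card_value_set_start Suc by simp
      then have "real (len \<gamma> k) powr \<gamma> \<le> real (card P) powr \<gamma>" using \<gamma> by (intro powr_mono2) auto
      then have "weight k \<le> N" using PN weight_le_len_powr[OF \<gamma>(1), of k] by linarith
      then show ?thesis using C by (intro mult_left_mono) auto
    qed
    finally show ?thesis by (simp add: algebra_simps)
  qed
  have "\<bar>dev \<alpha> F a b\<bar> \<le> (9 * C + 5 * D) * N"
    unfolding dF using d1 d2 d3 by (simp add: algebra_simps)
  then show ?thesis by (simp add: F_def N_def)
qed

lemma card_value_set_start_Suc_le: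
  assumes "0 < \<gamma>" "\<gamma> \<le> 1 / 2"
  shows "real (card (value_set \<gamma> \<inter> {..<start \<gamma> (Suc m)})) \<le> 4 * (real m + 1) * weight m powr (1 / \<gamma>)"
proof -
  have "card (value_set \<gamma> \<inter> {..<start \<gamma> (Suc m)}) \<le> (\<Sum>i<Suc m. 2 * len \<gamma> m)"
    unfolding card_value_set_start
  proof (intro sum_mono)
    fix i assume "i \<in> {..<Suc m}"
    then have "len \<gamma> i \<le> len \<gamma> m" "2 ^ i \<le> len \<gamma> i" using assms by (auto intro: len_mono two_power_le_len)
    then show "len \<gamma> i + 2 ^ i \<le> 2 * len \<gamma> m" by linarith
  qed
  then have "real (card (value_set \<gamma> \<inter> {..<start \<gamma> (Suc m)})) \<le> real (Suc m * (2 * len \<gamma> m))"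
    unfolding of_nat_le_iff by simp
  also have "\<dots> = 2 * (real m + 1) * real (len \<gamma> m)" by (simp add: algebra_simps)
  also have "\<dots> \<le> 2 * (real m + 1) * (2 * weight m powr (1 / \<gamma>))"
    using len_le assms by (intro mult_left_mono) auto
  finally show ?thesis by (simp add: algebra_simps)
qed

text \<open>Up to powers of m, N is at most \<open>2 powr (m / (2 * \<gamma>))\<close>, so
  \<open>N powr \<beta>\<close> has exponent (m/2) (\<beta>/\<gamma>); as \<beta>/\<gamma> < 1, an
  exponential factor is left over to beat every power of m.\<close>

lemma eventually_powr_le_chunk_dev:
  assumes \<gamma>: "0 < \<gamma>" "\<gamma> \<le> 1" and \<beta>: "\<beta> < \<gamma>"
  shows "\<forall>\<^sub>F m in sequentially. \<forall>N. 1 \<le> N \<longrightarrow> N \<le> 4 * (real m + 1) * weight m powr (1 / \<gamma>) \<longrightarrow>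
    N powr \<beta> \<le> sqrt (2 ^ m) / (2 * (real m + 2)\<^sup>2)"
proof -
  \<comment> \<open>The exponent \<gamma> - \<epsilon> may be negative, where \<open>powr\<close> is
    decreasing in its base.\<close>
  define \<kappa> where "\<kappa> = max \<beta> 0"
  define \<rho> where "\<rho> = \<kappa> / \<gamma>"
  define d where "d = (1 - \<rho>) / 2"
  have \<kappa>: "0 \<le> \<kappa>" "\<beta> \<le> \<kappa>" "\<kappa> < \<gamma>" using \<gamma> \<beta> by (auto simp: \<kappa>_def)
  have \<rho>: "0 \<le> \<rho>" "\<rho> < 1" using \<kappa> \<gamma> by (auto simp: \<rho>_def)
  have d: "0 < d" using \<rho> by (simp add: d_def)
  \<comment> \<open>The left side is the product of 4 (m + 2) and (m + 2)^4 from the bound on N with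
    the denominator 2 (m + 2)^2. The choice of d makes d m + \<rho> m / 2 equal to m/2.\<close>
  have "\<forall>\<^sub>F m in sequentially. 8 * (real m + 2) ^ 7 \<le> 2 powr (d * real m)"
    using d by real_asymp
  then show ?thesis
  proof (eventually_elim, intro allI impI)
    fix m and N :: real
    assume m: "8 * (real m + 2) ^ 7 \<le> 2 powr (d * real m)" and N: "1 \<le> N"
      and le: "N \<le> 4 * (real m + 1) * weight m powr (1 / \<gamma>)"
    have sq: "sqrt (2 ^ m) = 2 powr (real m / 2)"
      by (simp add: powr_half_sqrt[symmetric] powr_realpow[symmetric] powr_powr)
    have "N powr \<beta> \<le> N powr \<kappa>" using \<kappa> N by (intro powr_mono) auto
    also have "\<dots> \<le> (4 * (real m + 1) * weight m powr (1 / \<gamma>)) powr \<kappa>"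
      using N le \<kappa> by (intro powr_mono2) auto
    also have "\<dots> = (4 * (real m + 1)) powr \<kappa> * weight m powr \<rho>"
      using \<gamma> by (simp add: powr_mult powr_powr \<rho>_def)
    also have "weight m powr \<rho> = 2 powr (real m / 2 * \<rho>) * ((real m + 2) ^ 4) powr \<rho>"
      unfolding weight_def sq by (simp add: powr_mult powr_powr)
    also have "(4 * (real m + 1)) powr \<kappa> * (2 powr (real m / 2 * \<rho>) * ((real m + 2) ^ 4) powr \<rho>)
        \<le> (4 * (real m + 2)) * (2 powr (real m / 2 * \<rho>) * (real m + 2) ^ 4)"
    proof (intro mult_mono order_refl)
      have "(4 * (real m + 1)) powr \<kappa> \<le> (4 * (real m + 1)) powr 1"
        using \<kappa> \<gamma> by (intro powr_mono) auto
      then show "(4 * (real m + 1)) powr \<kappa> \<le> 4 * (real m + 2)" by simp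
      have "((real m + 2) ^ 4) powr \<rho> \<le> ((real m + 2) ^ 4) powr 1"
        using \<rho> by (intro powr_mono) (auto intro!: one_le_power)
      then show "((real m + 2) ^ 4) powr \<rho> \<le> (real m + 2) ^ 4" by simp
    qed auto
    also have "\<dots> = (8 * (real m + 2) ^ 7) * 2 powr (real m / 2 * \<rho>) / (2 * (real m + 2)\<^sup>2)"
      by (simp add: field_simps flip: power_add) (simp add: eval_nat_numeral algebra_simps)
    also have "\<dots> \<le> 2 powr (d * real m) * 2 powr (real m / 2 * \<rho>) / (2 * (real m + 2)\<^sup>2)"
      using m by (intro divide_right_mono mult_right_mono) auto
    also have "2 powr (d * real m) * 2 powr (real m / 2 * \<rho>) = sqrt (2 ^ m)"
      unfolding sq d_def by (simp add: field_simps flip: powr_add)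
    finally show "N powr \<beta> \<le> sqrt (2 ^ m) / (2 * (real m + 2)\<^sup>2)" .
  qed
qed

section \<open>Discrepancy\<close>

lemma abs_count_diff_eq:
  assumes inj: "inj_on s {1..N}" and N: "0 < N"
  shows "\<bar>real (count_in (\<lambda>n. frac (real (s n) * \<alpha>)) N {a..<b}) / real N - (b - a)\<bar>
    = \<bar>dev \<alpha> (s ` {1..N}) a b\<bar> / N"
proof -
  have "{k \<in> s ` {1..N}. frac (real k * \<alpha>) \<in> {a..<b}} = s ` {n \<in> {1..N}. frac (real (s n) * \<alpha>) \<in> {a..<b}}"
    by blast
  moreover have "inj_on s {n \<in> {1..N}. frac (real (s n) * \<alpha>) \<in> {a..<b}}"
    using inj by (rule inj_on_subset) auto
  ultimately have "card {k \<in> s ` {1..N}. frac (real k * \<alpha>) \<in> {a..<b}} = count_in (\<lambda>n. frac (real (s n) * \<alpha>)) N {a..<b}"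
    unfolding count_in_def by (simp only: card_image)
  moreover have "card (s ` {1..N}) = N" using card_image[OF inj] by simp
  ultimately have "dev \<alpha> (s ` {1..N}) a b
      = N * (real (count_in (\<lambda>n. frac (real (s n) * \<alpha>)) N {a..<b}) / real N - (b - a))"
    using N by (simp only: dev_eq_card[OF finite_imageI[OF finite_atLeastAtMost]]) (simp add: field_simps)
  then show ?thesis using N by (simp only: abs_mult) simp
qed

lemma discrepancy_le:
  assumes inj: "inj_on s {1..N}" and N: "0 < N"
    and E: "\<And>a b. 0 \<le> a \<Longrightarrow> a \<le> b \<Longrightarrow> b \<le> 1 \<Longrightarrow> \<bar>dev \<alpha> (s ` {1..N}) a b\<bar> \<le> E"
  shows "real N * discrepancy (\<lambda>n. frac (real (s n) * \<alpha>)) N \<le> E"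
proof -
  have "discrepancy (\<lambda>n. frac (real (s n) * \<alpha>)) N \<le> E / N"
    unfolding discrepancy_def
  proof (rule cSUP_least)
    have "(0, 1) \<in> {(a, b). 0 \<le> a \<and> a < b \<and> b \<le> (1::real)}" by simp
    then show "{(a, b). 0 \<le> a \<and> a < b \<and> b \<le> (1::real)} \<noteq> {}" by blast
  qed (use N E in \<open>auto simp only: mem_Collect_eq split_def abs_count_diff_eq[OF inj N] intro!: divide_right_mono\<close>)
  then show ?thesis using N by (simp add: field_simps)
qed

lemma abs_dev_le_discrepancy:
  assumes inj: "inj_on s {1..N}" and N: "0 < N" and ab: "0 \<le> a" "a < b" "b \<le> 1"
  shows "\<bar>dev \<alpha> (s ` {1..N}) a b\<bar> \<le> real N * discrepancy (\<lambda>n. frac (real (s n) * \<alpha>)) N"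
proof -
  have "(\<lambda>(a, b). \<bar>real (count_in (\<lambda>n. frac (real (s n) * \<alpha>)) N {a..<b}) / real N - (b - a)\<bar>) (a, b)
      \<le> discrepancy (\<lambda>n. frac (real (s n) * \<alpha>)) N"
    unfolding discrepancy_def
  proof (rule cSUP_upper)
    show "(a, b) \<in> {(a, b). 0 \<le> a \<and> a < b \<and> b \<le> 1}" using ab by simp
    have "\<bar>dev \<alpha> (s ` {1..N}) a b\<bar> / N \<le> 1" if "0 \<le> a" "a < b" "b \<le> 1" for a b
      using abs_dev_le_card[of a b \<alpha> "s ` {1..N}"] that N card_image_le[of "{1..N}" s]
      by (simp add: divide_le_eq)
    then show "bdd_above ((\<lambda>(a, b). \<bar>real (count_in (\<lambda>n. frac (real (s n) * \<alpha>)) N {a..<b}) / real N - (b - a)\<bar>)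
        ` {(a, b). 0 \<le> a \<and> a < b \<and> b \<le> 1})"
      by (intro bdd_aboveI[where M = 1]) (auto simp only: abs_count_diff_eq[OF inj N])
  qed
  then have "\<bar>dev \<alpha> (s ` {1..N}) a b\<bar> / N \<le> discrepancy (\<lambda>n. frac (real (s n) * \<alpha>)) N"
    by (simp only: prod.case abs_count_diff_eq[OF inj N])
  then show ?thesis using N by (simp add: field_simps)
qed

text \<open>The exceptional set is contained in the union of the integer translates of one null set,
  and there are only countably many.\<close>

lemma AE_periodic:
  fixes P :: "real \<Rightarrow> bool"
  assumes AE: "AE \<alpha> in lebesgue. \<alpha> \<in> {0..<1} \<longrightarrow> P \<alpha>" and per: "\<And>\<alpha>. P (frac \<alpha>) \<Longrightarrow> P \<alpha>"
  shows "AE \<alpha> in lebesgue. P \<alpha>"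
proof -
  obtain N where N: "N \<in> null_sets lebesgue" "{\<alpha>. \<not> (\<alpha> \<in> {0..<1} \<longrightarrow> P \<alpha>)} \<subseteq> N"
    using AE by (auto simp: eventually_ae_filter)
  then have neg: "negligible N" by (simp add: negligible_iff_null_sets)
  have "AE \<alpha> in lebesgue. \<alpha> \<notin> (+) (of_int z) ` N" for z :: int
    using negligible_translation[OF neg, of "of_int z"] by (intro AE_not_in) (simp add: negligible_iff_null_sets)
  then have "AE \<alpha> in lebesgue. \<forall>z::int. \<alpha> \<notin> (+) (of_int z) ` N"
    by (simp add: AE_all_countable)
  then show ?thesis
  proof eventually_elim
    case (elim \<alpha>)
    have "\<alpha> = of_int \<lfloor>\<alpha>\<rfloor> + frac \<alpha>" by (simp add: frac_def)
    then have "frac \<alpha> \<notin> N" using elim by (metis imageI)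
    moreover have "frac \<alpha> \<in> {0..<1}" by (simp add: frac_lt_1)
    ultimately have "P (frac \<alpha>)" using N(2) by blast
    then show ?case by (rule per)
  qed
qed

lemma frac_mult_frac: "frac (real k * frac \<alpha>) = frac (real k * \<alpha>)"
proof -
  have "frac (x + of_int z) = frac x" for x :: real and z by (simp add: frac_def)
  moreover have "real k * frac \<alpha> = real k * \<alpha> + of_int (- (int k * \<lfloor>\<alpha>\<rfloor>))" by (simp add: frac_def algebra_simps)
  ultimately show ?thesis by (simp only:)
qed

section \<open>Enumeration of the value set\<close>

lemma strict_mono_prefix:
  fixes e :: "nat \<Rightarrow> nat"
  assumes e: "strict_mono e"
  shows "e ` {..<card (range e \<inter> {..<x})} = range e \<inter> {..<x}"
proof -
  have "i < x" if "e i < x" for i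
    using strict_mono_imp_increasing[OF e, of i] that by linarith
  then have "range e \<inter> {..<x} = e ` {i. i < x \<and> e i < x}" by blast
  moreover obtain n where "{i. i < x \<and> e i < x} = {..<n}"
    using initial_segment_below[OF strict_mono_mono[OF e]] by blast
  ultimately have "range e \<inter> {..<x} = e ` {..<n}" by simp
  moreover have "card (e ` {..<n}) = n"
    using e by (simp add: card_image strict_mono_imp_inj_on)
  ultimately show ?thesis by simp
qed

lemma infinite_value_set: "infinite (value_set \<gamma>)"
proof
  assume fin: "finite (value_set \<gamma>)"
  define m where "m = Suc (card (value_set \<gamma>))"
  have "m = (\<Sum>i<m. 1)" by simp
  also have "\<dots> \<le> (\<Sum>i<m. len \<gamma> i + 2 ^ i)" by (intro sum_mono) (simp add: trans_le_add2)
  also have "\<dots> \<le> card (value_set \<gamma>)"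
    unfolding card_value_set_start[symmetric] using fin by (intro card_mono) auto
  finally show False by (simp add: m_def)
qed

lemma value_set_pos: "k \<in> value_set \<gamma> \<Longrightarrow> 0 < k"
  using value_set_below_start_0[of \<gamma>] by (force simp: start.simps)

text \<open>The shift passes from enumeration from 0 to indices from 1. Truncated subtraction makes
  \<open>seq \<gamma> 0\<close> equal to \<open>seq \<gamma> 1\<close>, so strict monotonicity holds
  only from 1 on.\<close>

definition seq :: "real \<Rightarrow> nat \<Rightarrow> nat" where
  "seq \<gamma> n = enumerate (value_set \<gamma>) (n - 1)"

lemma image_seq: "seq \<gamma> ` {1..N} = enumerate (value_set \<gamma>) ` {..<N}"
proof -
  have "(\<lambda>n. n - 1) ` {1..N} = {..<N}"
    by (auto simp: image_iff intro!: bexI[where x = "Suc _"])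
  then show ?thesis unfolding seq_def by (metis image_image)
qed

lemma strict_mono_on_seq: "strict_mono_on {1..} (seq \<gamma>)"
  by (auto simp: strict_mono_on_def seq_def infinite_value_set)

lemma image_seq_prefix: "seq \<gamma> ` {1..card (value_set \<gamma> \<inter> {..<x})} = value_set \<gamma> \<inter> {..<x}"
  unfolding image_seq
  using strict_mono_prefix[OF strict_mono_enumerate[OF infinite_value_set], of \<gamma> x]
  by (simp add: range_enumerate infinite_value_set)

text \<open>The (N+1)-st value serves as cutoff, so bounds for the value set below an arbitrary x
  reach every N.\<close>

lemma image_seq_eq: "seq \<gamma> ` {1..N} = value_set \<gamma> \<inter> {..<enumerate (value_set \<gamma>) N}"
proof -
  have "range (enumerate (value_set \<gamma>)) \<inter> {..<enumerate (value_set \<gamma>) N}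
      = enumerate (value_set \<gamma>) ` {..<N}"
    by (auto simp: infinite_value_set)
  then show ?thesis unfolding image_seq range_enumerate[OF infinite_value_set] by (rule sym)
qed

lemma inj_on_seq: "inj_on (seq \<gamma>) {1..N}"
  using strict_mono_on_imp_inj_on[OF strict_mono_on_seq] by (rule inj_on_subset) auto

lemma card_image_seq: "card (seq \<gamma> ` {1..N}) = N"
  using card_image[OF inj_on_seq] by simp

section \<open>Discrepancy bounds for the sequence\<close>

lemma discrepancy_seq_upper:
  assumes \<gamma>: "0 < \<gamma>" "\<gamma> \<le> 1 / 2"
    and dio: "\<exists>c>0. \<forall>(q::nat) (p::int). 1 \<le> q \<longrightarrow> c * real q powr - (1 + \<gamma>) \<le> \<bar>real q * \<alpha> - p\<bar>"
    and chk: "\<forall>\<^sub>F m in sequentially. \<forall>n\<le>2 ^ m. \<forall>a b. 0 \<le> a \<longrightarrow> a \<le> b \<longrightarrow> b \<le> 1 \<longrightarrow>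
      \<bar>dev \<alpha> (chunk (2 ^ Suc m) (stop \<gamma> m) n) a b\<bar> \<le> 8 * weight m"
  shows "(\<lambda>N. real N * discrepancy (\<lambda>n. frac (real (seq \<gamma> n) * \<alpha>)) N) \<in> O(\<lambda>N. real N powr \<gamma>)"
proof -
  obtain c where c: "0 < c" "\<And>(q::nat) (p::int). 1 \<le> q \<Longrightarrow> c * real q powr - (1 + \<gamma>) \<le> \<bar>real q * \<alpha> - p\<bar>"
    using dio by blast
  define C where "C = 6 / (c * (1 - 2 powr - \<gamma>))"
  have C: "0 \<le> C" using c powr_less_one[of 2 "- \<gamma>"] \<gamma> by (simp add: C_def)
  obtain m0 where m0: "\<And>m n a b. m0 \<le> m \<Longrightarrow> n \<le> 2 ^ m \<Longrightarrow> 0 \<le> a \<Longrightarrow> a \<le> b \<Longrightarrow> b \<le> 1 \<Longrightarrow>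
      \<bar>dev \<alpha> (chunk (2 ^ Suc m) (stop \<gamma> m) n) a b\<bar> \<le> 8 * weight m"
    using chk unfolding eventually_sequentially by blast
  \<comment> \<open>The summand \<open>2 ^ m0\<close> covers the finitely many early stages by the
    trivial bound, as weights are at least 1.\<close>
  define D :: real where "D = 8 + 2 ^ m0"
  have D: "\<bar>dev \<alpha> (chunk (2 ^ Suc m) (stop \<gamma> m) n) a b\<bar> \<le> D * weight m"
    if n: "n \<le> 2 ^ m" and ab: "0 \<le> a" "a \<le> b" "b \<le> 1" for m n a b
  proof (cases "m0 \<le> m")
    case True
    have "8 * weight m \<le> D * weight m"
      using weight_ge_1[of m] by (intro mult_right_mono) (auto simp: D_def)
    then show ?thesis using m0[OF True n ab] by linarith
  next
    case False
    have "\<bar>dev \<alpha> (chunk (2 ^ Suc m) (stop \<gamma> m) n) a b\<bar> \<le> real (card (chunk (2 ^ Suc m) (stop \<gamma> m) n))"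
      by (rule abs_dev_le_card[OF ab])
    also have "\<dots> = real n" by (subst card_chunk) auto
    also have "\<dots> \<le> 2 ^ m" using n by (metis of_nat_le_iff of_nat_numeral of_nat_power)
    also have "\<dots> \<le> 2 ^ m0" using False by (intro power_increasing) auto
    also have "\<dots> \<le> D * 1" by (simp add: D_def)
    also have "\<dots> \<le> D * weight m" using weight_ge_1 by (intro mult_left_mono) (auto simp: D_def)
    finally show ?thesis .
  qed
  have "norm (real N * discrepancy (\<lambda>n. frac (real (seq \<gamma> n) * \<alpha>)) N) \<le> (9 * C + 5 * D) * norm (real N powr \<gamma>)" for N
  proof (cases "N = 0")
    case False
    then have N: "0 < N" by simp
    have "real N * discrepancy (\<lambda>n. frac (real (seq \<gamma> n) * \<alpha>)) N \<le> (9 * C + 5 * D) * real N powr \<gamma>"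
    proof (rule discrepancy_le[OF inj_on_seq N])
      fix a b :: real assume ab: "0 \<le> a" "a \<le> b" "b \<le> 1"
      have "\<bar>dev \<alpha> (seq \<gamma> ` {1..N}) a b\<bar> \<le> (9 * C + 5 * D) * real (card (seq \<gamma> ` {1..N})) powr \<gamma>"
        unfolding image_seq_eq
      proof (rule abs_dev_value_set_le[OF \<gamma> ab C])
        show "\<bar>dev \<alpha> {B..<B + N} a b\<bar> \<le> C * real N powr \<gamma>" for B N
          unfolding C_def by (rule abs_dev_consecutive[OF c(1) \<gamma>(1) c(2) ab])
      qed (use D ab in \<open>auto simp: D_def\<close>)
      then show "\<bar>dev \<alpha> (seq \<gamma> ` {1..N}) a b\<bar> \<le> (9 * C + 5 * D) * real N powr \<gamma>"
        by (simp only: card_image_seq)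
    qed
    moreover have "0 \<le> real N * discrepancy (\<lambda>n. frac (real (seq \<gamma> n) * \<alpha>)) N"
      using abs_dev_le_discrepancy[OF inj_on_seq[of \<gamma> N] N, of 0 1 \<alpha>] by simp
    ultimately show ?thesis by simp
  qed simp
  then show ?thesis by (intro bigoI[where c = "9 * C + 5 * D"] always_eventually allI)
qed

text \<open>The initial segments just before and just after a block of powers differ by that block.
  Whatever the deviation before it, one of the two has at least half the deviation of the block,
  which explains the factor 2 in h.\<close>

lemma discrepancy_seq_lower:
  assumes \<gamma>: "0 < \<gamma>" "\<gamma> \<le> 1 / 2" and \<epsilon>: "0 < \<epsilon>"
    and chk: "\<forall>\<^sub>F m in sequentially.
      sqrt (2 ^ m) / (real m + 2)\<^sup>2 \<le> \<bar>dev \<alpha> (chunk (2 ^ Suc m) (stop \<gamma> m) (2 ^ m)) 0 (1 / 2)\<bar>"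
  shows "0 < limsup (\<lambda>N. ereal (real N * discrepancy (\<lambda>n. frac (real (seq \<gamma> n) * \<alpha>)) N / real N powr (\<gamma> - \<epsilon>)))"
    (is "0 < limsup (\<lambda>N. ereal (?f N))")
proof -
  have powr_le: "\<forall>\<^sub>F m in sequentially. \<forall>N. 1 \<le> N \<longrightarrow> N \<le> 4 * (real m + 1) * weight m powr (1 / \<gamma>) \<longrightarrow>
      N powr (\<gamma> - \<epsilon>) \<le> sqrt (2 ^ m) / (2 * (real m + 2)\<^sup>2)"
    using \<gamma> \<epsilon> by (intro eventually_powr_le_chunk_dev) auto
  have large: "\<forall>\<^sub>F m in sequentially. \<exists>N\<ge>m. 1 \<le> ?f N"
    using chk powr_le eventually_gt_at_top[of 0]
  proof eventually_elim
    case (elim m)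
    define A where "A = value_set \<gamma>"
    define F where "F = A \<inter> {..<stop \<gamma> m}"
    define G where "G = A \<inter> {..<start \<gamma> (Suc m)}"
    define c where "c = chunk (2 ^ Suc m) (stop \<gamma> m) (2 ^ m)"
    have c: "c \<subseteq> {stop \<gamma> m<..}" "finite c" unfolding c_def by (rule chunk_subset) simp
    have "stage \<gamma> m \<inter> {..<stop \<gamma> m} = {start \<gamma> m..<stop \<gamma> m}"
      unfolding stage_def c_def[symmetric] using c(1) by fastforce
    then have "F = (A \<inter> {..<start \<gamma> m}) \<union> {start \<gamma> m..<stop \<gamma> m}"
      unfolding F_def A_def value_set_split[OF start_le_stop less_imp_le[OF stop_less_start_Suc]] by (simp only:)
    then have "G = F \<union> c" unfolding G_def A_def value_set_Suc stage_def c_def by blast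
    moreover have "F \<inter> c = {}" using c(1) by (auto simp: F_def)
    ultimately have split: "dev \<alpha> G 0 (1 / 2) = dev \<alpha> F 0 (1 / 2) + dev \<alpha> c 0 (1 / 2)"
      using c(2) by (simp only:) (rule dev_Un_disjoint, auto simp: F_def)
    define h where "h = sqrt (2 ^ m) / (2 * (real m + 2)\<^sup>2)"
    have "2 * h \<le> \<bar>dev \<alpha> c 0 (1 / 2)\<bar>"
      using elim(1) unfolding c_def[symmetric] by (simp add: h_def)
    then have "h \<le> \<bar>dev \<alpha> F 0 (1 / 2)\<bar> \<or> h \<le> \<bar>dev \<alpha> G 0 (1 / 2)\<bar>"
      using split by linarith
    then obtain x where x: "stop \<gamma> m \<le> x" "x \<le> start \<gamma> (Suc m)" "h \<le> \<bar>dev \<alpha> (A \<inter> {..<x}) 0 (1 / 2)\<bar>"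
      unfolding F_def G_def using stop_less_start_Suc[of \<gamma> m] less_imp_le by blast
    define N where "N = card (A \<inter> {..<x})"
    \<comment> \<open>Each earlier stage holds at least one element, so the chosen N tends to
      infinity with m, as the limsup requires.\<close>
    have "m = (\<Sum>i<m. 1)" by simp
    also have "\<dots> \<le> (\<Sum>i<m. len \<gamma> i + 2 ^ i)" by (intro sum_mono) (simp add: trans_le_add2)
    also have "\<dots> \<le> N"
      unfolding card_value_set_start[symmetric] N_def A_def
      using x(1) start_le_stop[of \<gamma> m] by (intro card_mono) auto
    finally have mN: "m \<le> N" .
    then have N: "0 < N" using elim(3) by simp
    have "N \<le> card (value_set \<gamma> \<inter> {..<start \<gamma> (Suc m)})"
      unfolding N_def A_def using x(2) by (intro card_mono) auto
    then have "real N \<le> 4 * (real m + 1) * weight m powr (1 / \<gamma>)"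
      using card_value_set_start_Suc_le[OF \<gamma>, of m] by linarith
    then have "real N powr (\<gamma> - \<epsilon>) \<le> h" using elim(2) N by (simp add: h_def)
    also have "h \<le> \<bar>dev \<alpha> (seq \<gamma> ` {1..N}) 0 (1 / 2)\<bar>"
      using x(3) unfolding N_def A_def image_seq_prefix .
    also have "\<dots> \<le> real N * discrepancy (\<lambda>n. frac (real (seq \<gamma> n) * \<alpha>)) N"
      by (rule abs_dev_le_discrepancy[OF inj_on_seq N]) auto
    finally have "1 \<le> ?f N" using N by simp
    then show ?case using mN by blast
  qed
  have "1 \<le> limsup (\<lambda>N. ereal (?f N))"
  proof (rule ccontr)
    assume "\<not> ?thesis"
    then have "\<forall>\<^sub>F N in sequentially. ereal (?f N) < 1" by (intro Limsup_lessD) simp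
    then obtain N0 where N0: "\<And>N. N0 \<le> N \<Longrightarrow> ereal (?f N) < 1" by (auto simp: eventually_sequentially)
    obtain m0 where "\<And>m. m0 \<le> m \<Longrightarrow> \<exists>N\<ge>m. 1 \<le> ?f N" using large by (auto simp: eventually_sequentially)
    then obtain N where "max m0 N0 \<le> N" "1 \<le> ?f N" by (meson max.cobounded1)
    then show False using N0[of N] by simp
  qed
  then show ?thesis by (rule less_le_trans[rotated]) simp
qed

theorem theorem1:
  fixes \<gamma> :: real
  assumes "0 < \<gamma>" and "\<gamma> \<le> 1 / 2"
  shows "\<exists>a :: nat \<Rightarrow> nat.
           strict_mono_on {1..} a \<and> (\<forall>n\<ge>1. 0 < a n) \<and>
           (AE \<alpha> in lebesgue.
              (\<lambda>N. real N * discrepancy (\<lambda>n. frac (real (a n) * \<alpha>)) N)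
                \<in> O(\<lambda>N. real N powr \<gamma>) \<and>
              (\<forall>\<epsilon>>0. 0 < limsup (\<lambda>N.
                 ereal (real N * discrepancy (\<lambda>n. frac (real (a n) * \<alpha>)) N
                          / real N powr (\<gamma> - \<epsilon>)))))"
proof (intro exI[of _ "seq \<gamma>"] conjI allI impI)
  show "strict_mono_on {1..} (seq \<gamma>)" by (rule strict_mono_on_seq)
  show "0 < seq \<gamma> n" for n
    unfolding seq_def by (rule value_set_pos[OF enumerate_in_set[OF infinite_value_set]])
  show "AE \<alpha> in lebesgue.
      (\<lambda>N. real N * discrepancy (\<lambda>n. frac (real (seq \<gamma> n) * \<alpha>)) N) \<in> O(\<lambda>N. real N powr \<gamma>) \<and>
      (\<forall>\<epsilon>>0. 0 < limsup (\<lambda>N. ereal (real N * discrepancy (\<lambda>n. frac (real (seq \<gamma> n) * \<alpha>)) N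
        / real N powr (\<gamma> - \<epsilon>))))"
  \<comment> \<open>The almost-everywhere estimates concern \<alpha> in [0, 1); since the terms are
    integers, the points depend on \<alpha> only modulo 1.\<close>
  proof (rule AE_periodic, goal_cases)
    case 1
    show ?case
      using AE_diophantine[OF assms(1)] AE_abs_dev_chunk_le[of "stop \<gamma>", folded weight_def]
        AE_abs_dev_chunk_ge[of "stop \<gamma>"]
    proof eventually_elim
      case (elim \<alpha>)
      then show ?case
        using discrepancy_seq_upper[OF assms] discrepancy_seq_lower[OF assms] by blast
    qed
  next
    case (2 \<alpha>)
    then show ?case unfolding frac_mult_frac .
  qed
qed

end
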